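(* Let $\mathfrak a\subset\mathbb C[x_1,\dots,x_n]$ be a proper nonzero ideal generated by monomials and let $P=(0,\dots,0)\in\mathbb C^n$ be the origin. Then $$\operatorname{lct}_P(\mathfrak a)=\operatorname{rk}^G(P,\mathfrak a).$$
   Context: Here $X=\mathbb C^n$ with coordinate ring $\mathbb C[x_1,\dots,x_n]$. If $\mathfrak a=(f_1,\dots,f_r)$, the log canonical threshold of $\mathfrak a$ at $P\in V(\mathfrak a)$ is $$\operatorname{lct}_P(\mathfrak a)=\sup\Big\{s>0 \;\Big|\; \frac{1}{(\sum_{i=1}^r|f_i|^2)^s}\text{ is integrable around }P\Big\}$$ (integrable on some neighbourhood of $P$ with respect to Lebesgue measure). Let $\mathcal O_P$ be the local ring of $X$ at $P$ and $\mathfrak m_P$ its maximal ideal. A system of local parameters at $P$ is $T=\{y_1,\dots,y_n\}$ with $y_i\in\mathfrak m_P$ whose images form a basis of $\mathfrak m_P/\mathfrak m_P^2$; then $\mathcal O_P\subset\mathbb C\{y_1,\dots,y_n\}$, the ring of convergent power series. For $\lambda=(\lambda_1,\dots,\lambda_n)\in\mathbb Z_{\ge0}^n$ and $f\in\mathbb C\{y_1,\dots,y_n\}$, let $\operatorname{val}^T_\lambda(f)$ be the largest $k$ such that $f(t^{\lambda_1}y_1,\dots,t^{\lambda_n}y_n)=t^kg(y_1,\dots,y_n,t)$ for some $g\in\mathbb C\{y_1,\dots,y_n,t\}$ (with $\operatorname{val}^T_\lambda(0)=+\infty$). For a nonzero ideal $\mathfrak a$ put $\operatorname{ord}^T_\lambda(\mathfrak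 a)=\min\{\operatorname{val}^T_\lambda(f)\mid f\in\mathfrak a\}$. The $T$-stable rank is $$\operatorname{rk}^T(P,\mathfrak a)=\inf_\lambda \frac{\sum_{i=1}^n\lambda_i}{\operatorname{ord}^T_\lambda(\mathfrak a)},$$ the infimum over nonzero $\lambda\in\mathbb Z^n_{\ge0}$ (a quotient with zero denominator counts as $+\infty$), and the $G$-stable rank is $\operatorname{rk}^G(P,\mathfrak a)=\inf_T\operatorname{rk}^T(P,\mathfrak a)$, the infimum over all systems of local parameters $T$ at $P$. *)

theory Defs
  imports
    "HOL-Analysis.Analysis"
    "HOL-Library.Poly_Mapping"
    "HOL-Library.Extended_Nat"
    "HOL-Computational_Algebra.Fraction_Field"
begin

text \<open>
  A finite type \<open>'n\<close> with \<open>n\<close> elements indexes the variables, so \<open>\<complex>\<^sup>n\<close> is \<open>complex ^ 'n\<close>.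
  The order on \<open>'n\<close> is never used below: the library needs it only to show that the polynomial
  ring is an integral domain, which is what makes its fraction field available.
\<close>

type_synonym 'n mpol = "('n \<Rightarrow>\<^sub>0 nat) \<Rightarrow>\<^sub>0 complex"

type_synonym 'n ratfun = "'n mpol fract"

definition monom_eval :: "('v::finite \<Rightarrow>\<^sub>0 nat) \<Rightarrow> ('v \<Rightarrow> complex) \<Rightarrow> complex" where
  "monom_eval \<alpha> z = (\<Prod>i\<in>UNIV. z i ^ Poly_Mapping.lookup \<alpha> i)"

definition poly_eval :: "'n mpol \<Rightarrow> complex ^ 'n::finite \<Rightarrow> complex" where
  "poly_eval p x =
     (\<Sum>\<alpha>\<in>Poly_Mapping.keys p. Poly_Mapping.lookup p \<alpha> * monom_eval \<alpha> (\<lambda>i. x $ i))"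


subsection \<open>Ideals\<close>

text \<open>Ideals are submodules of the ring viewed as a module over itself.\<close>

lemma module_mult: "module ((*) :: 'a::comm_ring_1 \<Rightarrow> 'a \<Rightarrow> 'a)"
  by unfold_locales (simp_all add: algebra_simps)

abbreviation ideal_generated_by :: "'a::comm_ring_1 set \<Rightarrow> 'a set" where
  "ideal_generated_by B \<equiv> module.span (*) B"

definition monomial_ideal :: "'n mpol set \<Rightarrow> bool" where
  "monomial_ideal \<aa> \<longleftrightarrow>
     (\<exists>M. \<aa> = ideal_generated_by ((\<lambda>\<alpha>. Poly_Mapping.single \<alpha> 1) ` M))"


subsection \<open>Log canonical threshold\<close>

text \<open>
  The ideal is presented by a list of generators. On the common zero set of the generators the
  integrand below takes the value 0 instead of infinity; this is immaterial when the ideal is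
  nonzero, because the zero set is then Lebesgue negligible.
\<close>

definition lct :: "complex ^ 'n::finite \<Rightarrow> 'n mpol list \<Rightarrow> ennreal" where
  "lct P fs =
     Sup {ennreal s | s :: real. s > 0 \<and>
       (\<exists>U. open U \<and> P \<in> U \<and>
          set_integrable lborel U
            (\<lambda>x. 1 / (\<Sum>f\<leftarrow>fs. (cmod (poly_eval f x))\<^sup>2) powr s))}"


subsection \<open>The local ring and systems of local parameters\<close>

text \<open>
  The local ring at \<open>P\<close> consists of the fractions \<open>p / q\<close> with \<open>q\<close> nonvanishing at \<open>P\<close>, inside the
  field of rational functions.
\<close>

definition max_ideal :: "complex ^ 'n::{finite,linorder} \<Rightarrow> 'n ratfun set" where
  "max_ideal P = {Fract p q | p q. poly_eval q P \<noteq> 0 \<and> poly_eval p P = 0}"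

definition max_ideal_sq :: "complex ^ 'n::{finite,linorder} \<Rightarrow> 'n ratfun set" where
  "max_ideal_sq P =
     {\<Sum>j<k. u j * v j | (k::nat) u v. \<forall>j<k. u j \<in> max_ideal P \<and> v j \<in> max_ideal P}"

definition const_rat :: "complex \<Rightarrow> 'n::{finite,linorder} ratfun" where
  "const_rat c = Fract (Poly_Mapping.single 0 c) 1"

text \<open>
  The last two conjuncts say that the classes of the \<open>y i\<close> span \<open>\<mm>\<^sub>P / \<mm>\<^sub>P\<^sup>2\<close> and are linearly
  independent in it over \<open>\<complex>\<close>.
\<close>

definition local_parameters ::
    "complex ^ 'n::{finite,linorder} \<Rightarrow> ('n \<Rightarrow> 'n ratfun) \<Rightarrow> bool" where
  "local_parameters P y \<longleftrightarrow>
     (\<forall>i. y i \<in> max_ideal P) \<and>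
     (\<forall>f\<in>max_ideal P. \<exists>c. f - (\<Sum>i\<in>UNIV. const_rat (c i) * y i) \<in> max_ideal_sq P) \<and>
     (\<forall>c. (\<Sum>i\<in>UNIV. const_rat (c i) * y i) \<in> max_ideal_sq P \<longrightarrow> (\<forall>i. c i = 0))"

text \<open>
  The value of a rational function at a point where some representing fraction has nonzero
  denominator; it does not depend on that fraction.
\<close>

definition rat_eval :: "'n ratfun \<Rightarrow> complex ^ 'n::{finite,linorder} \<Rightarrow> complex" where
  "rat_eval f x =
     (THE v. \<exists>p q. f = Fract p q \<and> poly_eval q x \<noteq> 0 \<and> v = poly_eval p x / poly_eval q x)"


subsection \<open>Convergent power series and the valuations\<close>

text \<open>
  Power series are families of coefficients. The series in \<open>y\<^sub>1, \<dots>, y\<^sub>n\<close> are indexed by \<open>'n\<close>, those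
  in \<open>y\<^sub>1, \<dots>, y\<^sub>n, t\<close> by \<open>'n option\<close>, where \<open>None\<close> stands for \<open>t\<close>.
\<close>

type_synonym 'v pseries = "('v \<Rightarrow>\<^sub>0 nat) \<Rightarrow> complex"

definition ps_convergent :: "'v::finite pseries \<Rightarrow> bool" where
  "ps_convergent F \<longleftrightarrow>
     (\<exists>r>0. (\<lambda>\<alpha>. cmod (F \<alpha>) * r ^ (\<Sum>i\<in>UNIV. Poly_Mapping.lookup \<alpha> i)) summable_on UNIV)"

definition ps_eval :: "'v::finite pseries \<Rightarrow> ('v \<Rightarrow> complex) \<Rightarrow> complex" where
  "ps_eval F z = (\<Sum>\<^sub>\<infinity>\<alpha>. F \<alpha> * monom_eval \<alpha> z)"

text \<open>\<open>F\<close> is the image of \<open>f\<close> under the inclusion of the local ring into \<open>\<complex>{y\<^sub>1, \<dots>, y\<^sub>n}\<close>.\<close>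

definition has_expansion ::
    "complex ^ 'n::{finite,linorder} \<Rightarrow> ('n \<Rightarrow> 'n ratfun) \<Rightarrow> 'n ratfun \<Rightarrow> 'n pseries \<Rightarrow> bool" where
  "has_expansion P y f F \<longleftrightarrow>
     ps_convergent F \<and> (\<forall>\<^sub>F x in nhds P. rat_eval f x = ps_eval F (\<lambda>i. rat_eval (y i) x))"

text \<open>
  \<open>F(t\<^bsup>\<lambda>\<^sub>1\<^esup>y\<^sub>1, \<dots>, t\<^bsup>\<lambda>\<^sub>n\<^esup>y\<^sub>n) = t\<^sup>k g(y\<^sub>1, \<dots>, y\<^sub>n, t)\<close> for some convergent \<open>g\<close>; convergent power series
  are equal iff their sums agree near 0.
\<close>

definition t_power_divides :: "('n \<Rightarrow> nat) \<Rightarrow> nat \<Rightarrow> 'n::finite pseries \<Rightarrow> bool" where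
  "t_power_divides l k F \<longleftrightarrow>
     (\<exists>g :: 'n option pseries. ps_convergent g \<and>
        (\<exists>\<epsilon>>0. \<forall>y t. (\<forall>i. cmod (y i) < \<epsilon>) \<and> cmod t < \<epsilon> \<longrightarrow>
           ps_eval F (\<lambda>i. t ^ l i * y i) = t ^ k * ps_eval g (case_option t y)))"

definition val_ps :: "('n \<Rightarrow> nat) \<Rightarrow> 'n::finite pseries \<Rightarrow> enat" where
  "val_ps l F = Sup {enat k | k. t_power_divides l k F}"

text \<open>The expansion \<open>F\<close> is unique, so the supremum below is over one element.\<close>

definition val ::
    "complex ^ 'n::{finite,linorder} \<Rightarrow> ('n \<Rightarrow> 'n ratfun) \<Rightarrow> ('n \<Rightarrow> nat) \<Rightarrow> 'n ratfun \<Rightarrow> enat" where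
  "val P y l f = (SUP F \<in> {F. has_expansion P y f F}. val_ps l F)"

definition ord_ideal ::
    "complex ^ 'n::{finite,linorder} \<Rightarrow> ('n \<Rightarrow> 'n ratfun) \<Rightarrow> ('n \<Rightarrow> nat) \<Rightarrow> 'n mpol set \<Rightarrow> enat" where
  "ord_ideal P y l \<aa> = (INF f\<in>\<aa>. val P y l (Fract f 1))"


subsection \<open>Stable ranks\<close>

text \<open>In \<open>ennreal\<close> a nonzero number divided by 0 is infinite.\<close>

definition rkT ::
    "complex ^ 'n::{finite,linorder} \<Rightarrow> ('n \<Rightarrow> 'n ratfun) \<Rightarrow> 'n mpol set \<Rightarrow> ennreal" where
  "rkT P y \<aa> =
     (INF l \<in> {l. l \<noteq> (\<lambda>_. 0)}. of_nat (\<Sum>i\<in>UNIV. l i) / ennreal_of_enat (ord_ideal P y l \<aa>))"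

definition rkG :: "complex ^ 'n::{finite,linorder} \<Rightarrow> 'n mpol set \<Rightarrow> ennreal" where
  "rkG P \<aa> = (INF y \<in> {y. local_parameters P y}. rkT P y \<aa>)"

end

(*
  For a system of local parameters y and a weight l, the preimage under y of the polydisc of radii
  t^(l i) has volume at least of order t^(2 * sum l), because y is locally Lipschitz and locally onto.
  On it every f in the ideal is O(t^k), where k is the order of the ideal, so that integrability of the
  integrand with exponent s forces s * k <= sum l. Hence lct <= rkG.

  Conversely let s < s' < rkG. Already for the standard coordinates the inequalities s' * k <= sum l, over
  all weights l, say by linear programming duality that some convex combination beta of the exponents
  of the generating monomials satisfies s' * beta i <= 1 for all i. The sum of the absolute values of
  these monomials is at least the product of the |x i|^(beta i), and |x i|^(-2 s * beta i) with
  s * beta i < 1 is integrable near 0. Hence s <= lct.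
*)
theory Submission
  imports Defs
begin


subsection \<open>Polynomials and their values\<close>

text \<open>The volume bound works without a change of variables. A small ball is covered by the
  image of \<open>y\<close> through an open mapping theorem that uses the derivative at the single
  point 0, and volume is then compared by double counting pairs \<open>(x, w)\<close> with
  \<open>w\<close> close to the image of \<open>x\<close>. Invertibility of that derivative is the
  analytic form of the classes of \<open>y i\<close> spanning the cotangent space, because elements
  of the square of the maximal ideal vanish to first order. The duality has an arithmetic obstacle:
  separation yields a real normal vector while weights are integers. Scaling the vector makes the
  strict separation gap grow linearly, whereas the loss from rounding stays bounded. Two exponents
  are used because the duality gives only non-strict inequalities, while integrability of a negative
  power at 0 requires a strict one. The given generators \<open>fs\<close> may be arbitrary
  polynomials. On the unit ball every generating monomial is bounded by a multiple of the square
  root of the sum of the squared moduli of \<open>fs\<close>, which transfers the monomial estimate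
  to the actual integrand. Finiteness of the set of monomials is inherited from the list
  \<open>fs\<close> as well.\<close>

lemma poly_eval_superset:
  assumes "finite A" "Poly_Mapping.keys p \<subseteq> A"
  shows "poly_eval p x = (\<Sum>\<alpha>\<in>A. Poly_Mapping.lookup p \<alpha> * monom_eval \<alpha> (\<lambda>i. x $ i))"
  unfolding poly_eval_def using assms
  by (intro sum.mono_neutral_left) (auto simp: in_keys_iff)

lemma poly_eval_zero [simp]: "poly_eval 0 x = 0"
  by (simp add: poly_eval_def)

lemma poly_eval_add: "poly_eval (p + q) x = poly_eval p x + poly_eval q x"
proof -
  let ?A = "Poly_Mapping.keys p \<union> Poly_Mapping.keys q"
  have "finite ?A" "Poly_Mapping.keys (p + q) \<subseteq> ?A"
    using keys_add[of p q] by auto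
  then show ?thesis
    using poly_eval_superset[of ?A p] poly_eval_superset[of ?A q] poly_eval_superset[of ?A "p + q"]
    by (simp add: lookup_add algebra_simps sum.distrib)
qed

lemma poly_eval_uminus: "poly_eval (- p) x = - poly_eval p x"
  using poly_eval_add[of p "- p" x] by (simp add: add_eq_0_iff)

lemma poly_eval_diff: "poly_eval (p - q) x = poly_eval p x - poly_eval q x"
  using poly_eval_add[of p "- q" x] by (simp add: poly_eval_uminus)

lemma poly_eval_sum: "poly_eval (\<Sum>j\<in>J. p j) x = (\<Sum>j\<in>J. poly_eval (p j) x)"
  by (induction J rule: infinite_finite_induct) (auto simp: poly_eval_add)

lemma poly_eval_single:
  "poly_eval (Poly_Mapping.single \<alpha> c) x = c * monom_eval \<alpha> (\<lambda>i. x $ i)"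
  by (simp add: poly_eval_def)

lemma monom_eval_add: "monom_eval (\<alpha> + \<beta>) z = monom_eval \<alpha> z * monom_eval \<beta> z"
  by (simp add: monom_eval_def lookup_add power_add prod.distrib)

lemma monom_eval_0 [simp]: "monom_eval 0 z = 1"
  by (simp add: monom_eval_def)

lemma monom_eval_single: "monom_eval (Poly_Mapping.single i k) z = z i ^ k"
proof -
  have "z j ^ Poly_Mapping.lookup (Poly_Mapping.single i k) j = (if j = i then z i ^ k else 1)" for j
    by (simp add: lookup_single when_def)
  then show ?thesis
    by (simp add: monom_eval_def)
qed

lemma poly_eval_const [simp]: "poly_eval (Poly_Mapping.single 0 c) x = c"
  by (simp add: poly_eval_single)

lemma poly_eval_one [simp]: "poly_eval 1 x = 1"
  using poly_eval_const[of 1] by simp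

lemma poly_mapping_eq_sum_single:
  "p = (\<Sum>\<alpha>\<in>Poly_Mapping.keys p. Poly_Mapping.single \<alpha> (Poly_Mapping.lookup p \<alpha>))"
proof (rule poly_mapping_eqI)
  fix \<beta>
  have "(\<Sum>\<alpha>\<in>Poly_Mapping.keys p. Poly_Mapping.lookup (Poly_Mapping.single \<alpha> (Poly_Mapping.lookup p \<alpha>)) \<beta>)
      = (\<Sum>\<alpha>\<in>Poly_Mapping.keys p. if \<alpha> = \<beta> then Poly_Mapping.lookup p \<beta> else 0)"
    by (intro sum.cong) (auto simp: lookup_single when_def)
  then show "Poly_Mapping.lookup p \<beta> = Poly_Mapping.lookup
      (\<Sum>\<alpha>\<in>Poly_Mapping.keys p. Poly_Mapping.single \<alpha> (Poly_Mapping.lookup p \<alpha>)) \<beta>"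
    by (auto simp: lookup_sum in_keys_iff)
qed

lemma poly_eval_mult: "poly_eval (p * q) x = poly_eval p x * poly_eval q x"
proof -
  have "p * q = (\<Sum>\<alpha>\<in>Poly_Mapping.keys p. \<Sum>\<beta>\<in>Poly_Mapping.keys q.
      Poly_Mapping.single (\<alpha> + \<beta>) (Poly_Mapping.lookup p \<alpha> * Poly_Mapping.lookup q \<beta>))"
    by (subst poly_mapping_eq_sum_single[of p], subst poly_mapping_eq_sum_single[of q])
      (simp add: sum_product mult_single)
  then show ?thesis
    by (simp add: poly_eval_sum poly_eval_single monom_eval_add poly_eval_def[of p]
        poly_eval_def[of q] sum_product algebra_simps)
qed

definition poly_X :: "'n \<Rightarrow> 'n mpol" where
  "poly_X i = Poly_Mapping.single (Poly_Mapping.single i 1) 1"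

lemma poly_eval_X [simp]: "poly_eval (poly_X i) x = x $ i"
  by (simp add: poly_X_def poly_eval_single monom_eval_single)

text \<open>An induction principle for polynomial functions, which arise from constants and
  coordinates by sums and products. Continuity, differentiability and the local Lipschitz property
  all go through it.\<close>

lemma poly_eval_closure:
  fixes p :: "'n::finite mpol"
  assumes const: "\<And>c. Q (\<lambda>x. c)" and coord: "\<And>i. Q (\<lambda>x. x $ i)"
    and add: "\<And>f g. Q f \<Longrightarrow> Q g \<Longrightarrow> Q (\<lambda>x. f x + g x)"
    and mult: "\<And>f g. Q f \<Longrightarrow> Q g \<Longrightarrow> Q (\<lambda>x. f x * g x)"
  shows "Q (poly_eval p)"
proof -
  have pow: "Q (\<lambda>x. x $ i ^ k)" for i k
    by (induction k) (auto intro: const coord mult)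
  have prod: "Q (\<lambda>x. \<Prod>i\<in>I. x $ i ^ k i)" for I and k :: "'n \<Rightarrow> nat"
    by (induction I rule: infinite_finite_induct) (auto intro: const mult pow)
  have "Q (\<lambda>x. \<Sum>\<alpha>\<in>A. Poly_Mapping.lookup p \<alpha> * monom_eval \<alpha> (\<lambda>i. x $ i))" for A
    unfolding monom_eval_def
    by (induction A rule: infinite_finite_induct) (simp_all add: const mult prod add)
  then show ?thesis
    unfolding poly_eval_def[abs_def] .
qed

lemma continuous_on_poly_eval: "continuous_on S (poly_eval p)"
  by (rule poly_eval_closure) (auto intro!: continuous_intros)

lemma differentiable_poly_eval: "poly_eval p differentiable (at x)"
  by (rule poly_eval_closure)
    (auto intro!: derivative_intros bounded_linear_imp_differentiable bounded_linear_vec_nth)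

text \<open>Every nonconstant monomial is divisible by a variable.\<close>

lemma poly_vanishing_at_0:
  fixes p :: "'n::finite mpol"
  assumes "poly_eval p 0 = 0"
  obtains h where "p = (\<Sum>i\<in>UNIV. poly_X i * h i)"
proof -
  let ?gen = "\<lambda>p. \<exists>h. p = (\<Sum>i\<in>UNIV. poly_X i * h i)"
  have add: "?gen (p + q)" if p: "?gen p" and q: "?gen q" for p q :: "'n mpol"
  proof -
    obtain h k where "p = (\<Sum>i\<in>UNIV. poly_X i * h i)" "q = (\<Sum>i\<in>UNIV. poly_X i * k i)"
      using p q by blast
    then have "p + q = (\<Sum>i\<in>UNIV. poly_X i * (h i + k i))"
      by (simp add: sum.distrib distrib_left)
    then show ?thesis by (rule exI[where x = "\<lambda>i. h i + k i"])
  qed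
  have zero: "?gen 0"
    by (rule exI[where x = "\<lambda>_. 0"]) simp
  have mono: "?gen (Poly_Mapping.single \<alpha> c)" if nz: "\<alpha> \<noteq> 0" for \<alpha> :: "'n \<Rightarrow>\<^sub>0 nat" and c
  proof -
    obtain i where i: "Poly_Mapping.lookup \<alpha> i \<noteq> 0"
      using nz by (metis lookup_zero poly_mapping_eqI)
    \<comment> \<open>One factor \<open>poly_X i\<close> is split off; the truncated subtraction is
      exact because \<open>i\<close> occurs in \<open>\<alpha>\<close>.\<close>
    define \<beta> where "\<beta> = \<alpha> - Poly_Mapping.single i 1"
    have \<beta>: "\<alpha> = Poly_Mapping.single i 1 + \<beta>"
      using i by (intro poly_mapping_eqI) (auto simp: \<beta>_def lookup_add lookup_minus lookup_single when_def)
    have *: "Poly_Mapping.single \<alpha> c = poly_X i * Poly_Mapping.single \<beta> c"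
      by (simp add: \<beta> poly_X_def mult_single)
    show ?thesis
    proof (rule exI[where x = "\<lambda>j. if j = i then Poly_Mapping.single \<beta> c else 0"])
      have "(\<Sum>j\<in>UNIV. poly_X j * (if j = i then Poly_Mapping.single \<beta> c else 0))
          = (\<Sum>j\<in>UNIV. if j = i then poly_X i * Poly_Mapping.single \<beta> c else 0)"
        by (intro sum.cong) auto
      then show "Poly_Mapping.single \<alpha> c = (\<Sum>j\<in>UNIV. poly_X j * (if j = i then Poly_Mapping.single \<beta> c else 0))"
        using * by simp
    qed
  qed
  have "?gen (\<Sum>\<alpha>\<in>A. Poly_Mapping.single \<alpha> (Poly_Mapping.lookup p \<alpha>))"
    if "finite A" "0 \<notin> A" for A
    using that by (induction A rule: finite_induct) (use zero add mono in auto)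
  \<comment> \<open>At the origin every nonconstant monomial vanishes, so the value there is the
    constant coefficient.\<close>
  moreover have "0 \<notin> Poly_Mapping.keys p"
  proof -
    have eval0: "monom_eval \<alpha> (\<lambda>i::'n. 0 $ i) = (if \<alpha> = 0 then 1 else 0)" for \<alpha> :: "'n \<Rightarrow>\<^sub>0 nat"
      by (auto simp: monom_eval_def power_0_left intro: poly_mapping_eqI)
    have "poly_eval p 0 = (\<Sum>\<alpha>\<in>Poly_Mapping.keys p. if \<alpha> = 0 then Poly_Mapping.lookup p 0 else 0)"
      unfolding poly_eval_def eval0 by (intro sum.cong) auto
    then have "poly_eval p 0 = Poly_Mapping.lookup p 0"
      by (auto simp: in_keys_iff)
    then show ?thesis
      using assms by (simp add: in_keys_iff)
  qed
  ultimately have "?gen p"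
    by (subst poly_mapping_eq_sum_single) auto
  then show ?thesis
    using that by blast
qed


subsection \<open>Rational functions regular at a point\<close>

text \<open>Membership in the local ring at \<open>x\<close>. Exactly in this case the definite
  description in \<open>rat_eval\<close> has a witness.\<close>

definition regular_at :: "complex ^ 'n::{finite,linorder} \<Rightarrow> 'n ratfun \<Rightarrow> bool" where
  "regular_at x f \<longleftrightarrow> (\<exists>p q. f = Fract p q \<and> poly_eval q x \<noteq> 0)"

lemma poly_eval_nz: "poly_eval q x \<noteq> 0 \<Longrightarrow> q \<noteq> 0"
  by auto

text \<open>Two representing fractions satisfy a cross-multiplied polynomial identity; evaluating it
  at \<open>x\<close>, where both denominators are nonzero, gives equal quotients.\<close>

lemma rat_eval_Fract:
  assumes "poly_eval q x \<noteq> 0"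
  shows "rat_eval (Fract p q) x = poly_eval p x / poly_eval q x"
  unfolding rat_eval_def
proof (rule the_equality)
  show "\<exists>p' q'. Fract p q = Fract p' q' \<and> poly_eval q' x \<noteq> 0 \<and>
      poly_eval p x / poly_eval q x = poly_eval p' x / poly_eval q' x"
    using assms by blast
next
  fix v
  assume "\<exists>p' q'. Fract p q = Fract p' q' \<and> poly_eval q' x \<noteq> 0 \<and> v = poly_eval p' x / poly_eval q' x"
  then obtain p' q' where *: "Fract p q = Fract p' q'" "poly_eval q' x \<noteq> 0"
    "v = poly_eval p' x / poly_eval q' x" by blast
  then have "p * q' = p' * q"
    using assms by (simp add: eq_fract poly_eval_nz)
  then have "poly_eval p x * poly_eval q' x = poly_eval p' x * poly_eval q x"
    by (metis poly_eval_mult)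
  then show "v = poly_eval p x / poly_eval q x"
    using * assms by (simp add: frac_eq_eq)
qed

lemma regular_at_poly [simp]: "regular_at x (Fract p 1)"
  unfolding regular_at_def by (intro exI[of _ p] exI[of _ 1]) simp

lemma rat_eval_poly [simp]: "rat_eval (Fract p 1) x = poly_eval p x"
  by (simp add: rat_eval_Fract)

lemma regular_at_0 [simp]: "regular_at x 0"
  using regular_at_poly[of x 0] by (simp add: Zero_fract_def)

lemma rat_eval_0 [simp]: "rat_eval 0 = (\<lambda>x. 0)"
  by (auto simp: Zero_fract_def)

lemma
  assumes "regular_at x f" "regular_at x g"
  shows regular_at_add: "regular_at x (f + g)"
    and rat_eval_add: "rat_eval (f + g) x = rat_eval f x + rat_eval g x"
    and regular_at_mult: "regular_at x (f * g)"
    and rat_eval_mult: "rat_eval (f * g) x = rat_eval f x * rat_eval g x"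
proof -
  obtain p q p' q' where *: "f = Fract p q" "poly_eval q x \<noteq> 0" "g = Fract p' q'" "poly_eval q' x \<noteq> 0"
    using assms unfolding regular_at_def by blast
  then have "f + g = Fract (p * q' + p' * q) (q * q')" "f * g = Fract (p * p') (q * q')"
    by (auto simp: poly_eval_nz)
  then show "regular_at x (f + g)" "rat_eval (f + g) x = rat_eval f x + rat_eval g x"
    "regular_at x (f * g)" "rat_eval (f * g) x = rat_eval f x * rat_eval g x"
    using *(2,4) unfolding regular_at_def *(1,3)
    by (auto simp: rat_eval_Fract poly_eval_mult poly_eval_add add_divide_distrib
        simp del: add_fract mult_fract) (metis no_zero_divisors poly_eval_mult)+
qed

lemma eventually_poly_eval_nonzero:
  assumes "poly_eval q P \<noteq> 0"
  shows "\<forall>\<^sub>F x in nhds P. poly_eval q x \<noteq> 0"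
proof -
  have "open {x. poly_eval q x \<noteq> 0}"
    by (intro open_Collect_neq continuous_on_poly_eval continuous_intros)
  then show ?thesis
    using assms unfolding eventually_nhds
    by (intro exI[of _ "{x. poly_eval q x \<noteq> 0}"]) auto
qed

lemma eventually_regular_at:
  assumes "regular_at P f"
  shows "\<forall>\<^sub>F x in nhds P. regular_at x f"
proof -
  obtain p q where *: "f = Fract p q" "poly_eval q P \<noteq> 0"
    using assms unfolding regular_at_def by blast
  have "\<forall>\<^sub>F x in nhds P. poly_eval q x \<noteq> 0"
    by (rule eventually_poly_eval_nonzero[OF *(2)])
  then show ?thesis
    by eventually_elim (use * in \<open>auto simp: regular_at_def\<close>)
qed

text \<open>A single fraction represents \<open>f\<close> at all points near \<open>P\<close>, so
  analytic properties of quotients of polynomials carry over to \<open>rat_eval f\<close>.\<close>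

lemma rat_eval_eventually_eq:
  assumes "regular_at P f"
  obtains p q where "f = Fract p q" "poly_eval q P \<noteq> 0"
    "\<forall>\<^sub>F x in nhds P. poly_eval q x \<noteq> 0 \<and> rat_eval f x = poly_eval p x / poly_eval q x"
proof -
  obtain p q where *: "f = Fract p q" "poly_eval q P \<noteq> 0"
    using assms unfolding regular_at_def by blast
  have "\<forall>\<^sub>F x in nhds P. poly_eval q x \<noteq> 0"
    by (rule eventually_poly_eval_nonzero[OF *(2)])
  then have "\<forall>\<^sub>F x in nhds P. poly_eval q x \<noteq> 0 \<and> rat_eval f x = poly_eval p x / poly_eval q x"
    by eventually_elim (use * in \<open>auto simp: rat_eval_Fract\<close>)
  then show ?thesis using that * by blast
qed

lemma has_derivative_eventually_eq:
  assumes "(f has_derivative D) (at P)" "\<forall>\<^sub>F x in nhds P. f x = g x"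
  shows "(g has_derivative D) (at P)"
  using assms
  by (intro has_derivative_transform_eventually[OF assms(1)])
    (auto simp: eventually_nhds_conv_at)

lemma rat_eval_differentiable:
  assumes "regular_at P f"
  obtains D where "(rat_eval f has_derivative D) (at P)"
proof -
  obtain p q where *: "f = Fract p q" "poly_eval q P \<noteq> 0"
    "\<forall>\<^sub>F x in nhds P. poly_eval q x \<noteq> 0 \<and> rat_eval f x = poly_eval p x / poly_eval q x"
    using rat_eval_eventually_eq[OF assms] .
  have "(\<lambda>x. poly_eval p x / poly_eval q x) differentiable (at P)"
    using *(2) by (intro differentiable_divide differentiable_poly_eval)
  then obtain D where "((\<lambda>x. poly_eval p x / poly_eval q x) has_derivative D) (at P)"
    unfolding differentiable_def by blast
  then have "(rat_eval f has_derivative D) (at P)"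
    by (rule has_derivative_eventually_eq) (use *(3) in \<open>auto elim: eventually_mono\<close>)
  then show ?thesis using that by blast
qed

lemma has_derivative_rat_eval_add:
  assumes "regular_at P f" "regular_at P g"
    and "(rat_eval f has_derivative A) (at P)" "(rat_eval g has_derivative B) (at P)"
  shows "(rat_eval (f + g) has_derivative (\<lambda>h. A h + B h)) (at P)"
proof (rule has_derivative_eventually_eq)
  show "((\<lambda>x. rat_eval f x + rat_eval g x) has_derivative (\<lambda>h. A h + B h)) (at P)"
    by (intro derivative_intros assms)
  show "\<forall>\<^sub>F x in nhds P. rat_eval f x + rat_eval g x = rat_eval (f + g) x"
    using eventually_regular_at[OF assms(1)] eventually_regular_at[OF assms(2)]
    by eventually_elim (simp add: rat_eval_add)
qed

lemma has_derivative_rat_eval_mult: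
  assumes "regular_at P f" "regular_at P g"
    and "(rat_eval f has_derivative A) (at P)" "(rat_eval g has_derivative B) (at P)"
  shows "(rat_eval (f * g) has_derivative (\<lambda>h. rat_eval f P * B h + A h * rat_eval g P)) (at P)"
proof (rule has_derivative_eventually_eq)
  show "((\<lambda>x. rat_eval f x * rat_eval g x) has_derivative (\<lambda>h. rat_eval f P * B h + A h * rat_eval g P)) (at P)"
    by (intro derivative_intros assms)
  show "\<forall>\<^sub>F x in nhds P. rat_eval f x * rat_eval g x = rat_eval (f * g) x"
    using eventually_regular_at[OF assms(1)] eventually_regular_at[OF assms(2)]
    by eventually_elim (simp add: rat_eval_mult)
qed

lemma Fract_in_max_ideal:
  "poly_eval p P = 0 \<Longrightarrow> poly_eval q P \<noteq> 0 \<Longrightarrow> Fract p q \<in> max_ideal P"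
  unfolding max_ideal_def by blast

lemma max_idealD:
  assumes "f \<in> max_ideal P"
  shows "regular_at P f" "rat_eval f P = 0"
  using assms unfolding max_ideal_def regular_at_def by (auto simp: rat_eval_Fract)

text \<open>By the product rule, a product of two functions vanishing at \<open>P\<close> has
  derivative 0 there. A congruence modulo the square of the maximal ideal therefore becomes an
  equality of derivatives.\<close>

lemma max_ideal_sqD:
  assumes "f \<in> max_ideal_sq P"
  shows "regular_at P f" "(rat_eval f has_derivative (\<lambda>_. 0)) (at P)"
proof -
  obtain k :: nat and u v where uv: "f = (\<Sum>j<k. u j * v j)" "\<forall>j<k. u j \<in> max_ideal P \<and> v j \<in> max_ideal P"
    using assms unfolding max_ideal_sq_def by (auto)
  have prods: "regular_at P (a * b) \<and> (rat_eval (a * b) has_derivative (\<lambda>_. 0)) (at P)"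
    if "a \<in> max_ideal P" "b \<in> max_ideal P" for a b
  proof -
    note a = max_idealD[OF that(1)] and b = max_idealD[OF that(2)]
    obtain A B where "(rat_eval a has_derivative A) (at P)" "(rat_eval b has_derivative B) (at P)"
      using rat_eval_differentiable a b by metis
    from has_derivative_rat_eval_mult[OF a(1) b(1) this] show ?thesis
      using a b by (simp add: regular_at_mult)
  qed
  have "regular_at P (\<Sum>j<m. u j * v j) \<and> (rat_eval (\<Sum>j<m. u j * v j) has_derivative (\<lambda>_. 0)) (at P)"
    if "m \<le> k" for m
    using that
  proof (induction m)
    case 0
    then show ?case by simp
  next
    case (Suc m)
    then have "regular_at P (u m * v m) \<and> (rat_eval (u m * v m) has_derivative (\<lambda>_. 0)) (at P)"
      using uv(2) by (intro prods) auto
    with Suc show ?case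
      using has_derivative_rat_eval_add[of P "\<Sum>j<m. u j * v j" "u m * v m" "\<lambda>_. 0" "\<lambda>_. 0"]
      by (simp add: regular_at_add)
  qed
  then show "regular_at P f" "(rat_eval f has_derivative (\<lambda>_. 0)) (at P)"
    using uv(1) by auto
qed

lemma const_rat_simps [simp]:
  "regular_at P (const_rat c)" "rat_eval (const_rat c) x = c"
  by (simp_all add: const_rat_def)

text \<open>Regularity belongs to the conclusion because the sum rule for \<open>rat_eval\<close>
  asks for it at each step of the induction.\<close>

lemma rat_lincomb:
  fixes P :: "complex ^ 'n::{finite,linorder}"
  assumes "\<And>i. i \<in> I \<Longrightarrow> regular_at P (y i)" "\<And>i. i \<in> I \<Longrightarrow> (rat_eval (y i) has_derivative D i) (at P)"
  shows "regular_at P (\<Sum>i\<in>I. const_rat (c i) * y i) \<and>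
    (rat_eval (\<Sum>i\<in>I. const_rat (c i) * y i) has_derivative (\<lambda>h. \<Sum>i\<in>I. c i * D i h)) (at P)"
  using assms
proof (induction I rule: infinite_finite_induct)
  case (insert j J)
  have "(rat_eval (const_rat (c j)) has_derivative (\<lambda>_. 0)) (at P)"
    by (rule has_derivative_eventually_eq[of "\<lambda>_. c j"]) auto
  then have "(rat_eval (const_rat (c j) * y j) has_derivative (\<lambda>h. c j * D j h)) (at P)"
    using has_derivative_rat_eval_mult[of P "const_rat (c j)" "y j" "\<lambda>_. 0" "D j"] insert by simp
  with insert show ?case
    using has_derivative_rat_eval_add[of P "const_rat (c j) * y j" "\<Sum>i\<in>J. const_rat (c i) * y i"
        "\<lambda>h. c j * D j h" "\<lambda>h. \<Sum>i\<in>J. c i * D i h"]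
    by (simp add: regular_at_add regular_at_mult)
qed simp_all


subsection \<open>Functions that are Lipschitz near a point\<close>

text \<open>Both points vary near \<open>P\<close>, hence the product filter: the volume argument
  applies the bound on balls centred at points other than \<open>P\<close>.\<close>

definition lipschitz_near :: "'a::metric_space \<Rightarrow> ('a \<Rightarrow> 'b::metric_space) \<Rightarrow> bool" where
  "lipschitz_near P f \<longleftrightarrow>
     (\<exists>L. \<forall>\<^sub>F (x, y) in nhds P \<times>\<^sub>F nhds P. dist (f x) (f y) \<le> L * dist x y)"

lemma eventually_both:
  assumes "\<forall>\<^sub>F x in F. A x"
  shows "\<forall>\<^sub>F (x, y) in F \<times>\<^sub>F F. A x \<and> A y"
  using eventually_prodI[OF assms assms] by (simp add: case_prod_unfold)

lemma eventually_nhds_isCont_norm: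
  fixes f :: "'a::t2_space \<Rightarrow> 'b::real_normed_vector"
  assumes "isCont f P"
  shows "\<forall>\<^sub>F x in nhds P. norm (f x) \<le> norm (f P) + 1"
proof -
  have "(f \<longlongrightarrow> f P) (nhds P)"
    using assms by (simp add: continuous_at tendsto_nhds_iff isCont_def)
  then have "\<forall>\<^sub>F x in nhds P. dist (f x) (f P) < 1"
    by (rule tendstoD) simp
  then show ?thesis
  proof eventually_elim
    case (elim x)
    then show ?case
      using norm_triangle_sub[of "f x" "f P"] by (simp add: dist_norm)
  qed
qed

lemma lipschitz_near_const: "lipschitz_near P (\<lambda>x. c)"
  unfolding lipschitz_near_def by (intro exI[of _ 0]) (simp add: case_prod_unfold)

lemma lipschitz_near_nth: "lipschitz_near P (\<lambda>x. x $ i)"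
  unfolding lipschitz_near_def by (intro exI[of _ 1]) (simp add: dist_vec_nth_le case_prod_unfold)

lemma lipschitz_near_add:
  fixes f g :: "'a::metric_space \<Rightarrow> 'b::real_normed_vector"
  assumes "lipschitz_near P f" "lipschitz_near P g"
  shows "lipschitz_near P (\<lambda>x. f x + g x)"
proof -
  obtain L M where "\<forall>\<^sub>F (x, y) in nhds P \<times>\<^sub>F nhds P. dist (f x) (f y) \<le> L * dist x y"
    "\<forall>\<^sub>F (x, y) in nhds P \<times>\<^sub>F nhds P. dist (g x) (g y) \<le> M * dist x y"
    using assms unfolding lipschitz_near_def by blast
  then have "\<forall>\<^sub>F (x, y) in nhds P \<times>\<^sub>F nhds P. dist (f x + g x) (f y + g y) \<le> (L + M) * dist x y"
    by eventually_elim (auto simp: distrib_right intro: order_trans[OF dist_triangle_add])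
  then show ?thesis
    unfolding lipschitz_near_def by blast
qed

text \<open>Continuity at \<open>P\<close> supplies the local bounds on the two factors that the
  product estimate multiplies with the Lipschitz constants.\<close>

lemma lipschitz_near_mult:
  fixes f g :: "'a::metric_space \<Rightarrow> complex"
  assumes "lipschitz_near P f" "lipschitz_near P g" "isCont f P" "isCont g P"
  shows "lipschitz_near P (\<lambda>x. f x * g x)"
proof -
  obtain L M where L: "\<forall>\<^sub>F (x, y) in nhds P \<times>\<^sub>F nhds P. dist (f x) (f y) \<le> L * dist x y"
    and M: "\<forall>\<^sub>F (x, y) in nhds P \<times>\<^sub>F nhds P. dist (g x) (g y) \<le> M * dist x y"
    using assms unfolding lipschitz_near_def by blast
  define A B where "A = cmod (f P) + 1" and "B = cmod (g P) + 1"
  have "\<forall>\<^sub>F x in nhds P. cmod (f x) \<le> A \<and> cmod (g x) \<le> B"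
    using eventually_nhds_isCont_norm[OF assms(3)] eventually_nhds_isCont_norm[OF assms(4)]
    unfolding A_def B_def by eventually_elim auto
  from eventually_both[OF this] L M
  have "\<forall>\<^sub>F (x, y) in nhds P \<times>\<^sub>F nhds P. dist (f x * g x) (f y * g y) \<le> (A * M + L * B) * dist x y"
  proof eventually_elim
    case (elim z)
    obtain x y where z: "z = (x, y)" by force
    have "f x * g x - f y * g y = f x * (g x - g y) + (f x - f y) * g y"
      by (simp add: algebra_simps)
    then have "dist (f x * g x) (f y * g y) \<le> cmod (f x) * dist (g x) (g y) + dist (f x) (f y) * cmod (g y)"
      by (metis dist_norm norm_mult norm_triangle_ineq)
    also have "\<dots> \<le> A * (M * dist x y) + (L * dist x y) * B"
      using elim z by (intro add_mono mult_mono) (auto intro: order_trans[OF zero_le_dist] order_trans[OF norm_ge_zero])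
    finally show ?case
      using z by (simp add: algebra_simps)
  qed
  then show ?thesis
    unfolding lipschitz_near_def by blast
qed

lemma lipschitz_near_inverse:
  fixes f :: "'a::metric_space \<Rightarrow> complex"
  assumes "lipschitz_near P f" "isCont f P" "f P \<noteq> 0"
  shows "lipschitz_near P (\<lambda>x. inverse (f x))"
proof -
  obtain L where L: "\<forall>\<^sub>F (x, y) in nhds P \<times>\<^sub>F nhds P. dist (f x) (f y) \<le> L * dist x y"
    using assms unfolding lipschitz_near_def by blast
  have "isCont (\<lambda>x. inverse (f x)) P"
    using assms by (intro continuous_intros)
  from eventually_nhds_isCont_norm[OF this]
  have "\<forall>\<^sub>F x in nhds P. cmod (inverse (f x)) \<le> cmod (inverse (f P)) + 1" .
  moreover have "\<forall>\<^sub>F x in nhds P. f x \<noteq> 0"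
    using continuous_at_avoid[OF assms(2,3)] unfolding eventually_nhds_metric
    by (auto simp: dist_commute)
  ultimately have "\<forall>\<^sub>F x in nhds P. cmod (inverse (f x)) \<le> cmod (inverse (f P)) + 1 \<and> f x \<noteq> 0"
    by eventually_elim auto
  define A where "A = cmod (inverse (f P)) + 1"
  note * = \<open>\<forall>\<^sub>F x in nhds P. cmod (inverse (f x)) \<le> cmod (inverse (f P)) + 1 \<and> f x \<noteq> 0\<close>[folded A_def]
  from eventually_both[OF *] L
  have "\<forall>\<^sub>F (x, y) in nhds P \<times>\<^sub>F nhds P. dist (inverse (f x)) (inverse (f y)) \<le> (A * A * L) * dist x y"
  proof eventually_elim
    case (elim z)
    obtain x y where z: "z = (x, y)" by force
    have "inverse (f x) - inverse (f y) = inverse (f x) * inverse (f y) * (f y - f x)"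
      using elim z by (simp add: field_simps)
    then have "dist (inverse (f x)) (inverse (f y)) = cmod (inverse (f x)) * cmod (inverse (f y)) * dist (f x) (f y)"
      by (simp add: dist_norm norm_mult norm_minus_commute del: norm_inverse)
    also have "\<dots> \<le> A * A * (L * dist x y)"
      using elim z by (intro mult_mono) (auto simp: A_def simp del: norm_inverse)
    finally show ?case
      using z by (simp add: algebra_simps)
  qed
  then show ?thesis
    unfolding lipschitz_near_def by blast
qed

lemma lipschitz_near_cong:
  assumes "lipschitz_near P f" "\<forall>\<^sub>F x in nhds P. f x = g x"
  shows "lipschitz_near P g"
proof -
  obtain L where L: "\<forall>\<^sub>F (x, y) in nhds P \<times>\<^sub>F nhds P. dist (f x) (f y) \<le> L * dist x y"
    using assms unfolding lipschitz_near_def by blast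
  with eventually_both[OF assms(2)]
  have "\<forall>\<^sub>F (x, y) in nhds P \<times>\<^sub>F nhds P. dist (g x) (g y) \<le> L * dist x y"
    by eventually_elim auto
  then show ?thesis
    unfolding lipschitz_near_def by blast
qed

lemma lipschitz_near_vec:
  fixes f :: "'n::finite \<Rightarrow> 'a::metric_space \<Rightarrow> complex"
  assumes "\<And>i. lipschitz_near P (f i)"
  shows "lipschitz_near P (\<lambda>x. \<chi> i. f i x)"
proof -
  have "\<exists>L. \<forall>\<^sub>F (x, y) in nhds P \<times>\<^sub>F nhds P. dist (f i x) (f i y) \<le> L * dist x y" for i
    using assms unfolding lipschitz_near_def by blast
  then have "\<forall>i. \<exists>L. \<forall>\<^sub>F (x, y) in nhds P \<times>\<^sub>F nhds P. dist (f i x) (f i y) \<le> L * dist x y"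
    by blast
  from choice[OF this] obtain L
    where "\<forall>i. \<forall>\<^sub>F (x, y) in nhds P \<times>\<^sub>F nhds P. dist (f i x) (f i y) \<le> L i * dist x y" ..
  then have "\<forall>\<^sub>F z in nhds P \<times>\<^sub>F nhds P. \<forall>i. dist (f i (fst z)) (f i (snd z)) \<le> L i * dist (fst z) (snd z)"
    by (intro eventually_all_finite) (simp add: case_prod_unfold)
  then have "\<forall>\<^sub>F (x, y) in nhds P \<times>\<^sub>F nhds P. dist (\<chi> i. f i x) (\<chi> i. f i y) \<le> (\<Sum>i\<in>UNIV. L i) * dist x y"
  proof eventually_elim
    case (elim z)
    have "dist (\<chi> i. f i (fst z)) (\<chi> i. f i (snd z)) \<le> (\<Sum>i\<in>UNIV. dist (f i (fst z)) (f i (snd z)))"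
      using L2_set_le_sum_abs[of "\<lambda>i. dist (f i (fst z)) (f i (snd z))" UNIV] by (simp add: dist_vec_def)
    also have "\<dots> \<le> (\<Sum>i\<in>UNIV. L i * dist (fst z) (snd z))"
      using elim by (intro sum_mono) auto
    finally show ?case
      by (simp add: case_prod_unfold sum_distrib_right)
  qed
  then show ?thesis
    unfolding lipschitz_near_def by blast
qed

lemma lipschitz_nearE:
  assumes "lipschitz_near P f"
  obtains L r where "L > 0" "r > 0" "\<And>x y. x \<in> ball P r \<Longrightarrow> y \<in> ball P r \<Longrightarrow> dist (f x) (f y) \<le> L * dist x y"
proof -
  obtain L where L: "\<forall>\<^sub>F (x, y) in nhds P \<times>\<^sub>F nhds P. dist (f x) (f y) \<le> L * dist x y"
    using assms unfolding lipschitz_near_def by blast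
  then obtain A B where AB: "eventually A (nhds P)" "eventually B (nhds P)"
    "\<And>x y. A x \<Longrightarrow> B y \<Longrightarrow> dist (f x) (f y) \<le> L * dist x y"
    unfolding eventually_prod_filter by auto
  have "\<forall>\<^sub>F x in nhds P. A x \<and> B x"
    using AB by (auto intro: eventually_conj)
  then obtain r where r: "r > 0" "\<And>x. dist x P < r \<Longrightarrow> A x \<and> B x"
    unfolding eventually_nhds_metric by blast
  show ?thesis
  \<comment> \<open>The constant is raised to at least 1 so that it is positive and can be divided
    by.\<close>
  proof (rule that[of "max L 1" r])
    show "dist (f x) (f y) \<le> max L 1 * dist x y" if "x \<in> ball P r" "y \<in> ball P r" for x y
    proof -
      have "dist (f x) (f y) \<le> L * dist x y"
        using AB(3) r(2) that by (simp add: dist_commute)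
      also have "\<dots> \<le> max L 1 * dist x y"
        by (intro mult_right_mono) auto
      finally show ?thesis .
    qed
  qed (use r in auto)
qed

lemma lipschitz_near_poly_eval: "lipschitz_near P (poly_eval p)"
proof -
  \<comment> \<open>Continuity is carried along because closure of the Lipschitz property under
    products depends on it.\<close>
  have "lipschitz_near P (poly_eval p) \<and> isCont (poly_eval p) P"
    by (rule poly_eval_closure)
      (auto intro!: lipschitz_near_const lipschitz_near_nth lipschitz_near_add lipschitz_near_mult)
  then show ?thesis ..
qed

lemma lipschitz_near_rat_eval:
  assumes "regular_at P f"
  shows "lipschitz_near P (rat_eval f)"
proof -
  obtain p q where *: "f = Fract p q" "poly_eval q P \<noteq> 0"
    "\<forall>\<^sub>F x in nhds P. poly_eval q x \<noteq> 0 \<and> rat_eval f x = poly_eval p x / poly_eval q x"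
    using rat_eval_eventually_eq[OF assms] .
  have c: "isCont (poly_eval h) P" for h
    using continuous_on_poly_eval[of UNIV h] by (simp add: continuous_on_eq_continuous_at)
  have "lipschitz_near P (\<lambda>x. poly_eval p x * inverse (poly_eval q x))"
    using *(2) by (intro lipschitz_near_mult lipschitz_near_inverse lipschitz_near_poly_eval c continuous_intros)
  then show ?thesis
    by (rule lipschitz_near_cong) (use *(3) in \<open>auto elim: eventually_mono simp: field_simps\<close>)
qed


subsection \<open>Local parameters as coordinates\<close>

lemma has_derivative_vec:
  fixes f :: "'n::finite \<Rightarrow> 'a::real_normed_vector \<Rightarrow> 'b::euclidean_space"
  assumes "\<And>i. (f i has_derivative D i) (at a within S)"
  shows "((\<lambda>x. \<chi> i. f i x) has_derivative (\<lambda>h. \<chi> i. D i h)) (at a within S)"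
proof (rule has_derivative_componentwise_within[THEN iffD2], rule ballI)
  fix b :: "'b ^ 'n"
  assume "b \<in> Basis"
  then obtain i u where "b = axis i u"
    by (auto simp: Basis_vec_def)
  then show "((\<lambda>x. (\<chi> i. f i x) \<bullet> b) has_derivative (\<lambda>h. (\<chi> i. D i h) \<bullet> b)) (at a within S)"
    using has_derivative_inner_left[OF assms[of i], of u] by (simp add: inner_axis)
qed

text \<open>Injectivity comes from spanning: \<open>x $ j - P $ j\<close> is a combination of the
  \<open>y i\<close> modulo the square of the maximal ideal, so its derivative \<open>h $ j\<close>
  is the same combination of the derivatives of the \<open>y i\<close>, and it vanishes when
  \<open>D h = 0\<close>.\<close>

lemma local_parameters_derivative:
  fixes P :: "complex ^ 'n::{finite,linorder}"
  assumes "local_parameters P y"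
  obtains D where "((\<lambda>x. \<chi> i. rat_eval (y i) x) has_derivative D) (at P)" "inj D"
proof -
  have y: "regular_at P (y i)" "rat_eval (y i) P = 0" for i
    using assms max_idealD unfolding local_parameters_def by blast+
  have "\<exists>D. (rat_eval (y i) has_derivative D) (at P)" for i
    using rat_eval_differentiable[OF y(1), of i] by blast
  then obtain E where E: "\<And>i. (rat_eval (y i) has_derivative E i) (at P)"
    by metis
  define D where "D = (\<lambda>h. \<chi> i. E i h)"
  have D: "((\<lambda>x. \<chi> i. rat_eval (y i) x) has_derivative D) (at P)"
    unfolding D_def by (rule has_derivative_vec[OF E])
  have "inj D"
  proof -
    have lin: "linear D"
      using D has_derivative_linear by blast
    have "h = 0" if h: "D h = 0" for h
    proof -
      have "h $ j = 0" for j
      proof -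
        define X where "X = (Fract (poly_X j - Poly_Mapping.single 0 (P $ j)) 1 :: 'n ratfun)"
        have pe: "poly_eval (poly_X j - Poly_Mapping.single 0 (P $ j)) x = x $ j - P $ j" for x
          by (simp add: poly_eval_diff)
        have "X \<in> max_ideal P"
          unfolding X_def by (rule Fract_in_max_ideal) (simp_all add: pe)
        then obtain c where c: "X - (\<Sum>i\<in>UNIV. const_rat (c i) * y i) \<in> max_ideal_sq P"
          using assms unfolding local_parameters_def by blast
        note m = max_ideal_sqD[OF this]
        let ?s = "\<Sum>i\<in>UNIV. const_rat (c i) * y i"
        have s: "regular_at P ?s" "(rat_eval ?s has_derivative (\<lambda>h. \<Sum>i\<in>UNIV. c i * E i h)) (at P)"
          using rat_lincomb[of UNIV P y E c] y E by auto
        \<comment> \<open>The difference \<open>X - ?s\<close> lies in the square of the maximal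
          ideal and contributes derivative 0.\<close>
        have "(rat_eval ((X - ?s) + ?s) has_derivative (\<lambda>h. 0 + (\<Sum>i\<in>UNIV. c i * E i h))) (at P)"
          by (rule has_derivative_rat_eval_add[OF m(1) s(1) m(2) s(2)])
        then have 1: "(rat_eval X has_derivative (\<lambda>h. \<Sum>i\<in>UNIV. c i * E i h)) (at P)"
          by simp
        have "rat_eval X = (\<lambda>x. x $ j - P $ j)"
          by (auto simp: X_def pe)
        moreover have "((\<lambda>x. x $ j - P $ j) has_derivative (\<lambda>h. h $ j - 0)) (at P)"
          by (intro has_derivative_diff has_derivative_const bounded_linear_imp_has_derivative
              bounded_linear_vec_nth)
        ultimately have 2: "(rat_eval X has_derivative (\<lambda>h. h $ j)) (at P)"
          by simp
        have "h $ j = (\<Sum>i\<in>UNIV. c i * E i h)"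
          using fun_cong[OF has_derivative_unique[OF 2 1], of h] .
        also have "\<dots> = 0"
          using h by (auto simp: D_def vec_eq_iff)
        finally show ?thesis .
      qed
      then show ?thesis by (simp add: vec_eq_iff)
    qed
    then show ?thesis
      using lin by (simp add: linear_injective_0)
  qed
  with D show ?thesis using that by blast
qed


subsection \<open>Volumes of preimages of polydiscs\<close>

text \<open>
  Fubini for the set of pairs \<open>(x, w)\<close> with \<open>w \<in> Q\<close> and \<open>f x\<close> within \<open>\<rho>\<close> of \<open>w\<close>: each \<open>w\<close> sees at
  least a ball of radius \<open>\<rho> / L\<close>, and each \<open>x\<close> at most a ball of radius \<open>\<rho>\<close>.
\<close>

lemma lipschitz_emeasure_le:
  fixes f :: "'a::euclidean_space \<Rightarrow> 'a"
  assumes N: "open N" and L: "L > 0" and \<rho>: "\<rho> > 0"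
    and lip: "\<And>x y. x \<in> N \<Longrightarrow> y \<in> N \<Longrightarrow> dist (f x) (f y) \<le> L * dist x y"
    and Q: "Q \<in> sets borel" and S: "S \<in> sets borel"
    and surj: "\<And>w. w \<in> Q \<Longrightarrow> \<exists>x. ball x (\<rho> / L) \<subseteq> N \<and> f x = w"
    and sub: "\<And>x w. x \<in> N \<Longrightarrow> w \<in> Q \<Longrightarrow> dist (f x) w < \<rho> \<Longrightarrow> x \<in> S"
  shows "emeasure lborel Q \<le> ennreal (L ^ DIM('a)) * emeasure lborel S"
proof -
  define V where "V = unit_ball_vol (DIM('a))"
  have V: "V > 0"
    unfolding V_def by simp
  have cont: "continuous_on N f"
    using L by (intro lipschitz_on_continuous_on[of L] lipschitz_onI lip) auto
  define G where "G = (N \<times> UNIV) \<inter> (\<lambda>(x, w). dist (f x) w) -` {..<\<rho>} \<inter> (UNIV \<times> Q)"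
  have "continuous_on (N \<times> UNIV) (\<lambda>z. dist (f (fst z)) (snd z))"
    by (intro continuous_intros continuous_on_compose2[OF cont]) auto
  then have "open ((N \<times> UNIV) \<inter> (\<lambda>(x, w). dist (f x) w) -` {..<\<rho>})"
    unfolding case_prod_unfold
    by (intro continuous_open_preimage open_Times N) auto
  then have "(N \<times> UNIV) \<inter> (\<lambda>(x, w). dist (f x) w) -` {..<\<rho>} \<in> sets (borel \<Otimes>\<^sub>M borel)"
    by (subst borel_prod) (rule borel_open)
  moreover have "UNIV \<times> Q \<in> sets (borel \<Otimes>\<^sub>M borel)"
    using Q by (intro pair_measureI) auto
  ultimately have "G \<in> sets (borel \<Otimes>\<^sub>M borel)"
    unfolding G_def by (rule sets.Int)
  then have G: "G \<in> sets (lborel \<Otimes>\<^sub>M lborel)"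
    by (simp cong: sets_pair_measure_cong)
  let ?g = "\<lambda>x w. indicator G (x, w) :: ennreal"
  have Gm: "case_prod ?g \<in> borel_measurable (lborel \<Otimes>\<^sub>M lborel)"
    using G by (simp add: case_prod_unfold)
  have "emeasure lborel Q * ennreal (V * (\<rho> / L) ^ DIM('a))
      = (\<integral>\<^sup>+ w. ennreal (V * (\<rho> / L) ^ DIM('a)) * indicator Q w \<partial>lborel)"
    using Q by (subst nn_integral_cmult_indicator) (auto simp: mult.commute)
  also have "\<dots> \<le> (\<integral>\<^sup>+ w. (\<integral>\<^sup>+ x. ?g x w \<partial>lborel) \<partial>lborel)"
  proof (intro nn_integral_mono)
    fix w :: 'a
    show "ennreal (V * (\<rho> / L) ^ DIM('a)) * indicator Q w \<le> (\<integral>\<^sup>+ x. ?g x w \<partial>lborel)"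
    proof (cases "w \<in> Q")
      case True
      then obtain x where x: "ball x (\<rho> / L) \<subseteq> N" "f x = w"
        using surj by blast
      have xN: "x \<in> N"
        using x L \<rho> by (metis centre_in_ball divide_pos_pos subsetD)
      have "(z, w) \<in> G" if z: "z \<in> ball x (\<rho> / L)" for z
      proof -
        have "dist (f z) (f x) \<le> L * dist z x"
          using x z xN by (intro lip) auto
        also have "\<dots> < \<rho>"
          using z L by (simp add: dist_commute field_simps)
        finally show ?thesis
          using x z True by (auto simp: G_def)
      qed
      then have "indicator (ball x (\<rho> / L)) z \<le> ?g z w" for z
        by (auto simp: indicator_def)
      then have "(\<integral>\<^sup>+ z. indicator (ball x (\<rho> / L)) z \<partial>lborel) \<le> (\<integral>\<^sup>+ z. ?g z w \<partial>lborel)"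
        by (intro nn_integral_mono)
      then show ?thesis
        using True L \<rho> by (simp add: emeasure_ball V_def)
    qed auto
  qed
  also have "\<dots> = (\<integral>\<^sup>+ x. (\<integral>\<^sup>+ w. ?g x w \<partial>lborel) \<partial>lborel)"
    by (rule lborel_pair.Fubini'[OF Gm])
  also have "\<dots> \<le> (\<integral>\<^sup>+ x. ennreal (V * \<rho> ^ DIM('a)) * indicator S x \<partial>lborel)"
  proof (intro nn_integral_mono)
    fix x :: 'a
    show "(\<integral>\<^sup>+ w. ?g x w \<partial>lborel) \<le> ennreal (V * \<rho> ^ DIM('a)) * indicator S x"
    proof (cases "x \<in> S")
      case True
      have "(\<integral>\<^sup>+ w. ?g x w \<partial>lborel) \<le> (\<integral>\<^sup>+ w. indicator (ball (f x) \<rho>) w \<partial>lborel)"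
        by (intro nn_integral_mono) (auto simp: G_def indicator_def)
      then show ?thesis
        using True \<rho> by (simp add: emeasure_ball V_def)
    next
      case False
      then have "?g x w = 0" for w
        using sub by (auto simp: G_def indicator_def)
      then show ?thesis by simp
    qed
  qed
  also have "\<dots> = ennreal (V * \<rho> ^ DIM('a)) * emeasure lborel S"
    using S by (simp add: nn_integral_cmult_indicator)
  finally have *: "ennreal (V * (\<rho> / L) ^ DIM('a)) * emeasure lborel Q \<le> ennreal (V * \<rho> ^ DIM('a)) * emeasure lborel S"
    by (simp add: mult.commute)
  have c: "1 / (V * (\<rho> / L) ^ DIM('a)) * (V * (\<rho> / L) ^ DIM('a)) = 1"
    "1 / (V * (\<rho> / L) ^ DIM('a)) * (V * \<rho> ^ DIM('a)) = L ^ DIM('a)"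
    using V L \<rho> by (auto simp: field_simps)
  \<comment> \<open>The common factor is removed by multiplying with a finite reciprocal, which is
    safe even if a measure is infinite.\<close>
  have "ennreal (1 / (V * (\<rho> / L) ^ DIM('a))) * (ennreal (V * (\<rho> / L) ^ DIM('a)) * emeasure lborel Q)
      \<le> ennreal (1 / (V * (\<rho> / L) ^ DIM('a))) * (ennreal (V * \<rho> ^ DIM('a)) * emeasure lborel S)"
    by (rule mult_left_mono[OF *]) simp
  moreover have "ennreal (1 / (V * (\<rho> / L) ^ DIM('a))) * (ennreal (V * (\<rho> / L) ^ DIM('a)) * emeasure lborel Q)
      = emeasure lborel Q"
    using V L \<rho> c by (simp add: mult.assoc[symmetric] flip: ennreal_mult)
  moreover have "ennreal (1 / (V * (\<rho> / L) ^ DIM('a))) * (ennreal (V * \<rho> ^ DIM('a)) * emeasure lborel S)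
      = ennreal (L ^ DIM('a)) * emeasure lborel S"
    using V L \<rho> c by (simp add: mult.assoc[symmetric] flip: ennreal_mult)
  ultimately show ?thesis by simp
qed

text \<open>Each complex coordinate contributes two real basis vectors; this regroups products over
  real coordinates by complex coordinate.\<close>

lemma prod_Basis_complex_vec:
  "(\<Prod>b\<in>(Basis :: (complex ^ 'n::finite) set). F b) = (\<Prod>i\<in>UNIV. F (axis i 1) * F (axis i \<i>))"
proof -
  have "(Basis :: (complex ^ 'n) set) = (\<Union>i\<in>UNIV. {axis i 1, axis i \<i>})"
    by (auto simp: Basis_vec_def Basis_complex_def)
  also have "prod F \<dots> = (\<Prod>i\<in>UNIV. \<Prod>b\<in>{axis i 1, axis i \<i>}. F b)"
    by (intro prod.UNION_disjoint) (auto simp: axis_eq_axis)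
  finally show ?thesis
    by (simp add: axis_eq_axis)
qed

text \<open>Boxes in real and imaginary parts stand in for polydiscs because their measure is simply
  a product of side lengths.\<close>

lemma mem_cbox_complex_vec:
  fixes w :: "complex ^ 'n::finite"
  shows "w \<in> cbox (- (\<chi> i. Complex (a i) (a i))) (\<chi> i. Complex (a i) (a i)) \<longleftrightarrow>
    (\<forall>i. \<bar>Re (w $ i)\<bar> \<le> a i \<and> \<bar>Im (w $ i)\<bar> \<le> a i)"
proof -
  have "(\<forall>b\<in>Basis. P b) \<longleftrightarrow> (\<forall>i. P (axis i 1) \<and> P (axis i \<i>))" for P :: "complex ^ 'n \<Rightarrow> bool"
    by (auto simp: Basis_vec_def Basis_complex_def)
  then show ?thesis
    by (auto simp: mem_box inner_axis abs_le_iff minus_le_iff inner_complex_def)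
qed

lemma emeasure_cbox_complex_vec:
  assumes "\<And>i. a i \<ge> 0"
  shows "emeasure lborel (cbox (- (\<chi> i. Complex (a i) (a i))) (\<chi> i::'n::finite. Complex (a i) (a i)))
    = ennreal (\<Prod>i\<in>UNIV. (2 * a i)\<^sup>2)"
proof -
  have "emeasure lborel (cbox (- (\<chi> i. Complex (a i) (a i))) (\<chi> i::'n. Complex (a i) (a i)))
    = ennreal (\<Prod>b\<in>Basis. ((\<chi> i::'n. Complex (a i) (a i)) - (- (\<chi> i. Complex (a i) (a i)))) \<bullet> b)"
    using assms by (intro emeasure_lborel_cbox) (auto simp: Basis_vec_def Basis_complex_def inner_axis inner_complex_def)
  also have "(\<Prod>b\<in>Basis. ((\<chi> i::'n. Complex (a i) (a i)) - (- (\<chi> i. Complex (a i) (a i)))) \<bullet> b)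
      = (\<Prod>i\<in>UNIV. (2 * a i)\<^sup>2)"
    unfolding prod_Basis_complex_vec
    by (intro prod.cong) (auto simp: inner_axis inner_complex_def power2_eq_square)
  finally show ?thesis .
qed

text \<open>The constants \<open>c\<close> and \<open>\<delta>\<close> are uniform in the radii
  \<open>a\<close>, since these will shrink at different rates. \<open>lipschitz_emeasure_le\<close>
  is applied to a box \<open>Q\<close> inside the polydisc, whose points have preimages by the open
  mapping theorem.\<close>

lemma polydisc_preimage_emeasure:
  fixes Y :: "complex ^ 'n::finite \<Rightarrow> complex ^ 'n"
  assumes lip: "lipschitz_near 0 Y" and Y0: "Y 0 = 0"
    and D: "(Y has_derivative D) (at 0)" "inj D"
    and U: "open U" "0 \<in> U"
  obtains N c \<delta> where "open N" "N \<subseteq> U" "c > 0" "\<delta> > 0"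
    "\<And>a. (\<And>i. 0 < a i) \<Longrightarrow> (\<And>i. a i < \<delta>) \<Longrightarrow>
      {x\<in>N. \<forall>i. cmod (Y x $ i) \<le> a i} \<in> sets borel \<and>
      ennreal (c * (\<Prod>i\<in>UNIV. (a i)\<^sup>2)) \<le> emeasure lborel {x\<in>N. \<forall>i. cmod (Y x $ i) \<le> a i}"
proof -
  obtain L r0 where L: "L > 0" and r0: "r0 > 0"
    and lip: "\<And>x y. x \<in> ball 0 r0 \<Longrightarrow> y \<in> ball 0 r0 \<Longrightarrow> dist (Y x) (Y y) \<le> L * dist x y"
    using lipschitz_nearE[OF lip] by blast
  obtain r1 where r1: "r1 > 0" "ball 0 r1 \<subseteq> U"
    using U open_contains_ball by blast
  define r where "r = min r0 r1"
  have r: "r > 0" "ball 0 r \<subseteq> U"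
    using r0 r1 by (auto simp: r_def)
  have lip: "dist (Y x) (Y y) \<le> L * dist x y" if "x \<in> ball 0 r" "y \<in> ball 0 r" for x y
    using that by (intro lip) (auto simp: r_def)
  have cont: "continuous_on (ball 0 r) Y"
    using L by (intro lipschitz_on_continuous_on[of L] lipschitz_onI lip) auto
  have linD: "linear D"
    using D(1) has_derivative_linear by blast
  obtain D' where D': "linear D'" "\<And>x. D (D' x) = x"
    using linear_injective_isomorphism[OF linD D(2)] by metis
  \<comment> \<open>The radius is halved to leave room inside \<open>ball 0 r\<close> for a ball of
    radius \<open>\<rho> / L\<close> around each preimage.\<close>
  have "Y 0 \<in> interior (Y ` ball 0 (r / 2))"
  proof (rule sussmann_open_mapping[OF open_ball cont _ D(1), of D'])
    show "bounded_linear D'" "D \<circ> D' = id"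
      using D' by (auto simp: linear_conv_bounded_linear)
  qed (use r in auto)
  then obtain d where d: "d > 0" "ball 0 d \<subseteq> Y ` ball 0 (r / 2)"
    unfolding Y0 mem_interior by blast
  \<comment> \<open>The box has side \<open>a i / 2\<close> in each real direction, hence one factor
    4 per complex coordinate; the power of \<open>L\<close> is the loss in
    \<open>lipschitz_emeasure_le\<close>.\<close>
  define c where "c = 1 / (4 ^ CARD('n) * L ^ DIM(complex ^ 'n))"
  \<comment> \<open>The bound \<open>L * r\<close> forces \<open>\<rho> / L < r / 2\<close>, and
    \<open>d / CARD('n)\<close> keeps the box inside \<open>ball 0 d\<close>.\<close>
  define \<delta> where "\<delta> = min (L * r) (d / CARD('n))"
  show ?thesis
  proof (rule that[of "ball 0 r" c \<delta>])
    show "c > 0" "\<delta> > 0"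
      using L r d by (auto simp: c_def \<delta>_def)
    fix a :: "'n \<Rightarrow> real"
    assume a: "\<And>i. 0 < a i" "\<And>i. a i < \<delta>"
    let ?S = "{x \<in> ball 0 r. \<forall>i. cmod (Y x $ i) \<le> a i}"
    \<comment> \<open>With half-widths \<open>a i / 4\<close>, points of the box have coordinates of
      modulus at most \<open>a i / 2\<close>; the other half of \<open>a i\<close> absorbs the
      distance \<open>\<rho>\<close>.\<close>
    let ?v = "\<chi> i. Complex (a i / 4) (a i / 4)"
    define Q where "Q = cbox (- ?v) ?v"
    define \<rho> where "\<rho> = Min (range a) / 2"
    have \<rho>: "\<rho> > 0" "2 * \<rho> \<le> a i" for i
      using a by (auto simp: \<rho>_def)
    have \<rho>L: "\<rho> / L < r / 2"
    proof -
      have "2 * \<rho> < L * r"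
        \<comment> \<open>\<open>undefined\<close> serves as an arbitrary index.\<close>
        using \<rho>(2)[of undefined] a(2)[of undefined] by (simp add: \<delta>_def)
      then show ?thesis
        using L by (simp add: field_simps)
    qed
    have Qi: "cmod (w $ i) \<le> a i / 2" if "w \<in> Q" for w i
    proof -
      have "\<bar>Re (w $ i)\<bar> \<le> a i / 4" "\<bar>Im (w $ i)\<bar> \<le> a i / 4"
        using that mem_cbox_complex_vec[of w "\<lambda>i. a i / 4"] by (auto simp: Q_def)
      then show ?thesis
        using cmod_le[of "w $ i"] by linarith
    qed
    \<comment> \<open>As \<open>Y\<close> is known to be continuous only on the ball, each set is
      treated as the complement of a relatively open one.\<close>
    have Seq: "?S = (\<Inter>i. ball 0 r \<inter> (\<lambda>x. cmod (Y x $ i)) -` {..a i})"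
      by auto
    have "ball 0 r \<inter> (\<lambda>x. cmod (Y x $ i)) -` {..a i} \<in> sets borel" for i
    proof -
      have "continuous_on (ball 0 r) (\<lambda>x. cmod (Y x $ i))"
        by (intro continuous_intros cont)
      then have "open (ball 0 r \<inter> (\<lambda>x. cmod (Y x $ i)) -` {a i<..})"
        by (intro continuous_open_preimage) auto
      then have "ball 0 r - (ball 0 r \<inter> (\<lambda>x. cmod (Y x $ i)) -` {a i<..}) \<in> sets borel"
        by (intro sets.Diff) auto
      moreover have "ball 0 r - (ball 0 r \<inter> (\<lambda>x. cmod (Y x $ i)) -` {a i<..})
          = ball 0 r \<inter> (\<lambda>x. cmod (Y x $ i)) -` {..a i}"
        by auto
      ultimately show ?thesis by simp
    qed
    then have S: "?S \<in> sets borel"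
      unfolding Seq by (intro sets.finite_INT) auto
    have "emeasure lborel Q \<le> ennreal (L ^ DIM(complex ^ 'n)) * emeasure lborel ?S"
    proof (rule lipschitz_emeasure_le[OF open_ball L \<rho>(1) lip _ S])
      fix w assume w: "w \<in> Q"
      have "norm w \<le> (\<Sum>i\<in>UNIV. cmod (w $ i))"
        using L2_set_le_sum_abs[of "\<lambda>i. cmod (w $ i)" UNIV] by (simp add: norm_vec_def)
      also have "\<dots> < (\<Sum>i\<in>(UNIV :: 'n set). d / CARD('n))"
      proof (rule sum_strict_mono)
        fix i
        have "cmod (w $ i) \<le> a i / 2"
          using Qi w by blast
        also have "\<dots> < d / CARD('n)"
          using a(1)[of i] a(2)[of i] unfolding \<delta>_def by linarith
        finally show "cmod (w $ i) < d / CARD('n)" .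
      qed auto
      finally have "w \<in> ball 0 d"
        by simp
      then obtain x where x: "x \<in> ball 0 (r / 2)" "Y x = w"
        using d by blast
      have "dist x 0 + \<rho> / L \<le> r"
        using x(1) \<rho>L unfolding mem_ball dist_commute[of 0 x] by linarith
      then have "ball x (\<rho> / L) \<subseteq> ball 0 r"
        by (simp add: ball_subset_ball_iff)
      then show "\<exists>x. ball x (\<rho> / L) \<subseteq> ball 0 r \<and> Y x = w"
        using x(2) by blast
    next
      fix x w assume x: "x \<in> ball 0 r" "w \<in> Q" "dist (Y x) w < \<rho>"
      have "cmod (Y x $ i) \<le> a i" for i
      proof -
        have "cmod (Y x $ i) \<le> dist (Y x $ i) (w $ i) + cmod (w $ i)"
          using norm_triangle_sub[of "Y x $ i" "w $ i"] by (simp add: dist_norm)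
        also have "\<dots> \<le> \<rho> + a i / 2"
          using x Qi[of w i] dist_vec_nth_le[of "Y x" i w] by simp
        finally show ?thesis
          using \<rho>(2)[of i] by simp
      qed
      then show "x \<in> ?S"
        using x by auto
    qed (auto simp: Q_def)
    moreover have "emeasure lborel Q = ennreal (\<Prod>i\<in>UNIV. (2 * (a i / 4))\<^sup>2)"
      unfolding Q_def using a(1) by (intro emeasure_cbox_complex_vec) (auto intro: less_imp_le)
    moreover have "(\<Prod>i\<in>(UNIV::'n set). (2 * (a i / 4))\<^sup>2) = (\<Prod>i\<in>UNIV. (a i)\<^sup>2) / 4 ^ CARD('n)"
      by (simp add: power_divide prod_dividef)
    ultimately have *: "ennreal ((\<Prod>i\<in>UNIV. (a i)\<^sup>2) / 4 ^ CARD('n))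
        \<le> ennreal (L ^ DIM(complex ^ 'n)) * emeasure lborel ?S"
      by simp
    have "ennreal (1 / L ^ DIM(complex ^ 'n)) * ennreal ((\<Prod>i\<in>UNIV. (a i)\<^sup>2) / 4 ^ CARD('n))
        \<le> ennreal (1 / L ^ DIM(complex ^ 'n)) * (ennreal (L ^ DIM(complex ^ 'n)) * emeasure lborel ?S)"
      by (rule mult_left_mono[OF *]) simp
    moreover have "ennreal (1 / L ^ DIM(complex ^ 'n)) * (ennreal (L ^ DIM(complex ^ 'n)) * emeasure lborel ?S)
       = emeasure lborel ?S"
      using L by (simp add: mult.assoc[symmetric] flip: ennreal_mult)
    moreover have "ennreal (1 / L ^ DIM(complex ^ 'n)) * ennreal ((\<Prod>i\<in>UNIV. (a i)\<^sup>2) / 4 ^ CARD('n))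
       = ennreal (c * (\<Prod>i\<in>UNIV. (a i)\<^sup>2))"
      using L by (simp add: c_def prod_nonneg mult.commute flip: ennreal_mult)
    ultimately have "ennreal (c * (\<Prod>i\<in>UNIV. (a i)\<^sup>2)) \<le> emeasure lborel ?S"
      by simp
    with S show "?S \<in> sets borel \<and> ennreal (c * (\<Prod>i\<in>UNIV. (a i)\<^sup>2)) \<le> emeasure lborel ?S"
      by blast
  qed (use r in auto)
qed


subsection \<open>Integrability bounds the valuation\<close>

lemma AE_inner_Basis_nonzero: "AE x::'a::euclidean_space in lborel. \<forall>b\<in>Basis. x \<bullet> b \<noteq> 0"
proof (rule AE_finite_allI)
  fix b :: 'a
  assume b: "b \<in> Basis"
  have "closed {x. x \<bullet> b = 0}"
    by (intro closed_Collect_eq continuous_intros)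
  then have "{x. x \<bullet> b = 0} \<in> null_sets lborel"
    using negligible_standard_hyperplane[OF b, of 0]
    by (simp add: negligible_iff_null_sets null_sets_completion_iff)
  from AE_not_in[OF this] show "AE x in lborel. x \<bullet> b \<noteq> 0"
    by simp
qed simp

text \<open>Monomials vanish only on the coordinate hyperplanes, so this makes the zero set of a
  nonzero monomial ideal negligible.\<close>

lemma AE_coordinates_nonzero: "AE x::complex ^ 'n::finite in lborel. \<forall>i. x $ i \<noteq> 0"
  using AE_inner_Basis_nonzero[where 'a = "complex ^ 'n"]
proof eventually_elim
  case (elim x)
  have "x \<bullet> axis i 1 \<noteq> 0" for i :: 'n
    using elim by (simp add: axis_in_Basis_iff Basis_complex_def)
  then have "Re (x $ i) \<noteq> 0" for i
    by (simp add: inner_axis)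
  then show ?case
    by (metis zero_complex.sel(1))
qed

text \<open>For use in contrapositive form: where some element of the ideal is nonzero, some
  generator is nonzero.\<close>

lemma ideal_generated_by_eval_0:
  assumes "p \<in> ideal_generated_by B" "\<And>f. f \<in> B \<Longrightarrow> poly_eval f x = 0"
  shows "poly_eval p x = 0"
  using assms(1)
proof (induction rule: module.span_induct_alt[OF module_mult, consumes 1, case_names base step])
  case (step c b y)
  then show ?case
    using assms(2) by (simp add: poly_eval_add poly_eval_mult)
qed simp

lemma monom_eval_bound:
  assumes "\<And>i. cmod (z i) \<le> r"
  shows "cmod (monom_eval \<alpha> z) \<le> r ^ (\<Sum>i\<in>UNIV. Poly_Mapping.lookup \<alpha> i)"
  unfolding monom_eval_def prod_norm[symmetric] power_sum norm_power
  by (intro prod_mono conjI power_mono assms) auto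

text \<open>Absolute convergence at radius \<open>r\<close> gives one majorant series for all
  arguments in the closed polydisc of that radius.\<close>

lemma ps_eval_bounded:
  assumes "ps_convergent g"
  obtains B r where "r > 0" "\<And>z. (\<And>i. cmod (z i) \<le> r) \<Longrightarrow> cmod (ps_eval g z) \<le> B"
proof -
  obtain r where r: "r > 0" "(\<lambda>\<alpha>. cmod (g \<alpha>) * r ^ (\<Sum>i\<in>UNIV. Poly_Mapping.lookup \<alpha> i)) summable_on UNIV"
    using assms unfolding ps_convergent_def by blast
  have "cmod (ps_eval g z) \<le> (\<Sum>\<^sub>\<infinity>\<alpha>. cmod (g \<alpha>) * r ^ (\<Sum>i\<in>UNIV. Poly_Mapping.lookup \<alpha> i))"
    if z: "\<And>i. cmod (z i) \<le> r" for z
  proof -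
    have le: "cmod (g \<alpha> * monom_eval \<alpha> z) \<le> cmod (g \<alpha>) * r ^ (\<Sum>i\<in>UNIV. Poly_Mapping.lookup \<alpha> i)" for \<alpha>
      unfolding norm_mult by (intro mult_left_mono monom_eval_bound z) auto
    have sm: "(\<lambda>\<alpha>. norm (g \<alpha> * monom_eval \<alpha> z)) summable_on UNIV"
      by (rule summable_on_comparison_test[OF r(2)]) (use le in auto)
    have "cmod (ps_eval g z) \<le> (\<Sum>\<^sub>\<infinity>\<alpha>. cmod (g \<alpha> * monom_eval \<alpha> z))"
      unfolding ps_eval_def by (rule norm_infsum_bound[OF sm])
    also have "\<dots> \<le> (\<Sum>\<^sub>\<infinity>\<alpha>. cmod (g \<alpha>) * r ^ (\<Sum>i\<in>UNIV. Poly_Mapping.lookup \<alpha> i))"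
      by (rule infsum_mono[OF sm r(2)]) (rule le)
    finally show ?thesis .
  qed
  then show ?thesis
    using that r(1) by blast
qed

text \<open>The successor turns the hypothesis into a strict inequality, which yields an element of
  \<open>S\<close>; with 0 in its place an empty \<open>S\<close> would be a counterexample.\<close>

lemma enat_Suc_le_Sup:
  assumes "enat (Suc k) \<le> Sup S"
  obtains x where "x \<in> S" "enat (Suc k) \<le> x"
proof -
  have "enat k < Sup S"
    using assms by (metis enat_ord_simps(2) lessI less_le_trans)
  then obtain x where "x \<in> S" "enat k < x"
    by (auto simp: less_Sup_iff)
  then show ?thesis
    using that by (cases x) auto
qed

text \<open>Writing each parameter as \<open>t ^ l i * z i\<close> with small \<open>z i\<close>
  puts the expansion into the form whose power of \<open>t\<close> splits off, and the remaining
  series is bounded. The neighbourhood of \<open>P\<close> is fixed before \<open>t\<close>, which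
  later tends to 0.\<close>

lemma val_bound:
  assumes k: "enat (Suc k) \<le> val P y l f"
  obtains C \<delta> where "\<delta> > 0"
    "\<forall>\<^sub>F x in nhds P. \<forall>t::real. 0 < t \<longrightarrow> t < \<delta> \<longrightarrow> (\<forall>i. cmod (rat_eval (y i) x) \<le> \<delta> * t ^ l i) \<longrightarrow>
      cmod (rat_eval f x) \<le> C * t ^ Suc k"
proof -
  from enat_Suc_le_Sup[OF k[unfolded val_def]]
  obtain v where "v \<in> val_ps l ` {F. has_expansion P y f F}" "enat (Suc k) \<le> v" .
  then obtain F where F: "has_expansion P y f F" "enat (Suc k) \<le> val_ps l F"
    by blast
  from enat_Suc_le_Sup[OF F(2)[unfolded val_ps_def]]
  obtain v where "v \<in> {enat k |k. t_power_divides l k F}" "enat (Suc k) \<le> v" .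
  then obtain m where m: "t_power_divides l m F" "Suc k \<le> m"
    by auto
  obtain g \<epsilon> where g: "ps_convergent g" "\<epsilon> > 0"
    "\<And>y t. (\<forall>i. cmod (y i) < \<epsilon>) \<and> cmod t < \<epsilon> \<Longrightarrow>
           ps_eval F (\<lambda>i. t ^ l i * y i) = t ^ m * ps_eval g (case_option t y)"
    using m(1) unfolding t_power_divides_def by blast
  obtain B r where B: "r > 0" "\<And>z. (\<And>i. cmod (z i) \<le> r) \<Longrightarrow> cmod (ps_eval g z) \<le> B"
    using ps_eval_bounded[OF g(1)] by blast
  \<comment> \<open>The bound 1 makes powers of \<open>t\<close> decrease in the exponent,
    \<open>r\<close> keeps arguments where \<open>g\<close> is bounded, and
    \<open>\<epsilon> / 2\<close> gives the strict inequalities required by the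
    factorization.\<close>
  define \<delta> where "\<delta> = min 1 (min r (\<epsilon> / 2))"
  have \<delta>: "\<delta> > 0" "\<delta> \<le> 1" "\<delta> \<le> r" "\<delta> < \<epsilon>"
    using B(1) g(2) by (auto simp: \<delta>_def)
  have "\<forall>\<^sub>F x in nhds P. rat_eval f x = ps_eval F (\<lambda>i. rat_eval (y i) x)"
    using F(1) unfolding has_expansion_def by blast
  then have "\<forall>\<^sub>F x in nhds P. \<forall>t::real. 0 < t \<longrightarrow> t < \<delta> \<longrightarrow> (\<forall>i. cmod (rat_eval (y i) x) \<le> \<delta> * t ^ l i) \<longrightarrow>
      cmod (rat_eval f x) \<le> B * t ^ Suc k"
  proof (eventually_elim, intro allI impI)
    fix x and t :: real
    assume x: "rat_eval f x = ps_eval F (\<lambda>i. rat_eval (y i) x)"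
      and t: "0 < t" "t < \<delta>" "\<forall>i. cmod (rat_eval (y i) x) \<le> \<delta> * t ^ l i"
    define z where "z i = rat_eval (y i) x / of_real t ^ l i" for i
    have z: "cmod (z i) \<le> \<delta>" for i
      using t by (simp add: z_def norm_divide norm_power field_simps)
    have "rat_eval (y i) x = of_real t ^ l i * z i" for i
      using t by (simp add: z_def)
    then have "rat_eval f x = ps_eval F (\<lambda>i. of_real t ^ l i * z i)"
      using x by simp
    also have "\<dots> = of_real t ^ m * ps_eval g (case_option (of_real t) z)"
      using z \<delta> t by (intro g(3)) (auto intro: le_less_trans)
    finally have "cmod (rat_eval f x) = t ^ m * cmod (ps_eval g (case_option (of_real t) z))"
      using t by (simp add: norm_mult norm_power)
    also have "\<dots> \<le> t ^ Suc k * B"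
    proof (rule mult_mono)
      show "t ^ m \<le> t ^ Suc k"
        using t \<delta> m(2) by (intro power_decreasing) auto
      show "cmod (ps_eval g (case_option (of_real t) z)) \<le> B"
      proof (rule B(2))
        fix i show "cmod (case_option (of_real t) z i) \<le> r"
          using z[of "the i"] \<delta> t by (cases i) auto
      qed
    qed (use t in auto)
    finally show "cmod (rat_eval f x) \<le> B * t ^ Suc k"
      by (simp add: mult.commute)
  qed
  with \<delta>(1) that show ?thesis by blast
qed

text \<open>Common constants for all generators. \<open>A\<close> is positive even for the empty
  list because its power will appear as a denominator.\<close>

lemma val_bound_list:
  assumes "\<And>f. f \<in> set fs \<Longrightarrow> enat (Suc k) \<le> val P y l (Fract f 1)"
  shows "\<exists>A>0. \<exists>\<delta>>0. \<forall>\<^sub>F x in nhds P. \<forall>t::real. 0 < t \<longrightarrow> t < \<delta> \<longrightarrow>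
      (\<forall>i. cmod (rat_eval (y i) x) \<le> \<delta> * t ^ l i) \<longrightarrow>
      (\<Sum>f\<leftarrow>fs. (cmod (poly_eval f x))\<^sup>2) \<le> A * (t ^ Suc k)\<^sup>2"
  using assms
proof (induction fs)
  case Nil
  show ?case
    by (intro exI[of _ 1] conjI) auto
next
  case (Cons f fs)
  from Cons.IH[OF Cons.prems[OF list.set_intros(2)]]
  obtain A \<delta> where A: "A > 0" "\<delta> > 0" "\<forall>\<^sub>F x in nhds P. \<forall>t::real. 0 < t \<longrightarrow> t < \<delta> \<longrightarrow>
      (\<forall>i. cmod (rat_eval (y i) x) \<le> \<delta> * t ^ l i) \<longrightarrow>
      (\<Sum>f\<leftarrow>fs. (cmod (poly_eval f x))\<^sup>2) \<le> A * (t ^ Suc k)\<^sup>2"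
    by blast
  have "enat (Suc k) \<le> val P y l (Fract f 1)"
    using Cons by simp
  from val_bound[OF this] obtain C \<delta>' where C: "\<delta>' > 0"
    "\<forall>\<^sub>F x in nhds P. \<forall>t::real. 0 < t \<longrightarrow> t < \<delta>' \<longrightarrow> (\<forall>i. cmod (rat_eval (y i) x) \<le> \<delta>' * t ^ l i) \<longrightarrow>
      cmod (rat_eval (Fract f 1) x) \<le> C * t ^ Suc k" .
  define d where "d = min \<delta> \<delta>'"
  have "\<forall>\<^sub>F x in nhds P. \<forall>t::real. 0 < t \<longrightarrow> t < d \<longrightarrow>
      (\<forall>i. cmod (rat_eval (y i) x) \<le> d * t ^ l i) \<longrightarrow>
      (\<Sum>f\<leftarrow>f # fs. (cmod (poly_eval f x))\<^sup>2) \<le> (A + C\<^sup>2) * (t ^ Suc k)\<^sup>2"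
    using A(3) C(2)
  proof (eventually_elim, intro allI impI)
    fix x and t :: real
    assume *: "\<forall>t::real. 0 < t \<longrightarrow> t < \<delta> \<longrightarrow> (\<forall>i. cmod (rat_eval (y i) x) \<le> \<delta> * t ^ l i) \<longrightarrow>
      (\<Sum>f\<leftarrow>fs. (cmod (poly_eval f x))\<^sup>2) \<le> A * (t ^ Suc k)\<^sup>2"
     "\<forall>t::real. 0 < t \<longrightarrow> t < \<delta>' \<longrightarrow> (\<forall>i. cmod (rat_eval (y i) x) \<le> \<delta>' * t ^ l i) \<longrightarrow>
      cmod (rat_eval (Fract f 1) x) \<le> C * t ^ Suc k"
     and t: "0 < t" "t < d" "\<forall>i. cmod (rat_eval (y i) x) \<le> d * t ^ l i"
    have "d * t ^ l i \<le> \<delta> * t ^ l i" "d * t ^ l i \<le> \<delta>' * t ^ l i" for i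
      using t by (auto intro!: mult_right_mono simp: d_def)
    then have "\<forall>i. cmod (rat_eval (y i) x) \<le> \<delta> * t ^ l i" "\<forall>i. cmod (rat_eval (y i) x) \<le> \<delta>' * t ^ l i"
      using t(3) by (blast intro: order_trans)+
    then have "(\<Sum>f\<leftarrow>fs. (cmod (poly_eval f x))\<^sup>2) \<le> A * (t ^ Suc k)\<^sup>2" "cmod (poly_eval f x) \<le> C * t ^ Suc k"
      using * t by (auto simp: d_def)
    moreover from this(2) have "(cmod (poly_eval f x))\<^sup>2 \<le> (C * t ^ Suc k)\<^sup>2"
      by (intro power_mono) auto
    ultimately show "(\<Sum>f\<leftarrow>f # fs. (cmod (poly_eval f x))\<^sup>2) \<le> (A + C\<^sup>2) * (t ^ Suc k)\<^sup>2"
      by (simp add: power_mult_distrib distrib_right)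
  qed
  moreover have "A + C\<^sup>2 > 0" "d > 0"
    using A C by (auto simp: d_def intro: add_pos_nonneg)
  ultimately show ?case by blast
qed

text \<open>
  On the preimage of a polydisc of radii \<open>t ^ l i\<close>, whose volume is of order \<open>t\<close> to the power
  \<open>2 * (\<Sum>i. l i)\<close>, the integrand is at least of order \<open>t\<close> to the power \<open>- 2 * k * s\<close>.
\<close>

lemma integrable_imp_exponent_le:
  fixes y :: "'n::{finite,linorder} \<Rightarrow> 'n ratfun"
  assumes y: "local_parameters 0 y"
    and val: "\<And>f. f \<in> set fs \<Longrightarrow> enat (Suc k) \<le> val 0 y l (Fract f 1)"
    and nz: "AE x in lborel. \<exists>f\<in>set fs. poly_eval f x \<noteq> 0"
    and U: "open U" "0 \<in> U" and s: "s > 0"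
    and int: "set_integrable lborel U (\<lambda>x. 1 / (\<Sum>f\<leftarrow>fs. (cmod (poly_eval f x))\<^sup>2) powr s)"
  shows "s * real (Suc k) \<le> real (\<Sum>i\<in>UNIV. l i)"
proof (rule ccontr)
  assume contr: "\<not> s * real (Suc k) \<le> real (\<Sum>i\<in>UNIV. l i)"
  define G where "G x = (\<Sum>f\<leftarrow>fs. (cmod (poly_eval f x))\<^sup>2)" for x
  define Y where "Y x = (\<chi> i. rat_eval (y i) x)" for x
  obtain A \<delta> where A: "A > 0" "\<delta> > 0" "\<forall>\<^sub>F x in nhds 0. \<forall>t::real. 0 < t \<longrightarrow> t < \<delta> \<longrightarrow>
      (\<forall>i. cmod (rat_eval (y i) x) \<le> \<delta> * t ^ l i) \<longrightarrow> G x \<le> A * (t ^ Suc k)\<^sup>2"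
    using val_bound_list[of fs k 0 y l, OF val] unfolding G_def by blast
  then obtain V where V: "open V" "0 \<in> V" "\<And>x t. x \<in> V \<Longrightarrow> 0 < t \<Longrightarrow> t < \<delta> \<Longrightarrow>
      (\<forall>i. cmod (Y x $ i) \<le> \<delta> * t ^ l i) \<Longrightarrow> G x \<le> A * (t ^ Suc k)\<^sup>2"
    unfolding eventually_nhds Y_def by auto
  have y0: "regular_at 0 (y i)" "rat_eval (y i) 0 = 0" for i
    using y max_idealD unfolding local_parameters_def by blast+
  obtain D where D: "(Y has_derivative D) (at 0)" "inj D"
    using local_parameters_derivative[OF y] unfolding Y_def[abs_def] by blast
  have lipY: "lipschitz_near 0 Y"
    unfolding Y_def[abs_def] by (intro lipschitz_near_vec lipschitz_near_rat_eval y0)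
  have Y0: "Y 0 = 0"
    by (simp add: Y_def y0 vec_eq_iff)
  have UV: "open (U \<inter> V)" "0 \<in> U \<inter> V"
    using U V by auto
  obtain N c \<delta>1 where N: "open N" "N \<subseteq> U \<inter> V" "c > 0" "\<delta>1 > 0"
    "\<And>a. (\<And>i. 0 < a i) \<Longrightarrow> (\<And>i. a i < \<delta>1) \<Longrightarrow>
      {x\<in>N. \<forall>i. cmod (Y x $ i) \<le> a i} \<in> sets borel \<and>
      ennreal (c * (\<Prod>i\<in>UNIV. (a i)\<^sup>2)) \<le> emeasure lborel {x\<in>N. \<forall>i. cmod (Y x $ i) \<le> a i}"
    using polydisc_preimage_emeasure[OF lipY Y0 D UV] by blast
  \<comment> \<open>Halving \<open>\<delta>1\<close> keeps the radius \<open>d * t ^ l i\<close>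
    strictly below it even when \<open>l i = 0\<close>.\<close>
  define d where "d = min \<delta> (\<delta>1 / 2)"
  have d: "d > 0" "d \<le> \<delta>" "d < \<delta>1"
    using A N by (auto simp: d_def)
  define h where "h x = indicator U x * (1 / G x powr s)" for x
  have int': "integrable lborel h"
    using int unfolding set_integrable_def h_def[abs_def] G_def by simp
  define I where "I = (\<integral>x. h x \<partial>lborel)"
  have G0: "G x \<ge> 0" for x
    unfolding G_def by (intro sum_list_nonneg) auto
  have h0: "h x \<ge> 0" for x
    by (simp add: h_def)
  have I: "(\<integral>\<^sup>+x. ennreal (h x) \<partial>lborel) = ennreal I"
    unfolding I_def using int' h0 by (intro nn_integral_eq_integral) auto
  have I0: "I \<ge> 0"
    unfolding I_def by (intro integral_nonneg_AE) (use h0 in auto)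
  \<comment> \<open>At a zero of \<open>G\<close> the formal value of \<open>h\<close> is 0 rather
    than infinite, so the lower bound on \<open>h\<close> is claimed only almost everywhere.\<close>
  have nz': "AE x in lborel. G x > 0"
    using nz
  proof eventually_elim
    case (elim x)
    then have "G x \<noteq> 0"
      unfolding G_def by (subst sum_list_nonneg_eq_0_iff) auto
    then show ?case
      using G0[of x] by simp
  qed
  define \<Lambda> where "\<Lambda> = (\<Sum>i\<in>UNIV. l i)"
  define K where "K = c * (d\<^sup>2) ^ CARD('n) / A powr s"
  define e where "e = 2 * (s * real (Suc k) - real \<Lambda>)"
  have e: "e > 0"
    using contr by (simp add: e_def \<Lambda>_def)
  have K: "K > 0"
    using N A d by (simp add: K_def)
  have main: "K * exp (e * u) \<le> I" if u: "u > 0" "exp (- u) < \<delta>" for u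
  proof -
    \<comment> \<open>In terms of \<open>u\<close> the limit at \<open>t = 0\<close> is a limit at
      infinity, and all powers of \<open>t\<close> merge into the single exponential
      \<open>exp (e * u)\<close>.\<close>
    define t where "t = exp (- u)"
    have t: "0 < t" "t < \<delta>" "t \<le> 1"
      using u by (auto simp: t_def)
    define a where "a i = d * t ^ l i" for i
    have a: "0 < a i" "a i < \<delta>1" for i
    proof -
      show "0 < a i"
        using d t by (simp add: a_def)
      have "d * t ^ l i \<le> d * 1"
        using d t by (intro mult_left_mono power_le_one) auto
      then show "a i < \<delta>1"
        using d(3) by (simp add: a_def)
    qed
    let ?S = "{x\<in>N. \<forall>i. cmod (Y x $ i) \<le> a i}"
    have S: "?S \<in> sets borel" "ennreal (c * (\<Prod>i\<in>UNIV. (a i)\<^sup>2)) \<le> emeasure lborel ?S"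
      using N(5)[of a] a by blast+
    \<comment> \<open>The integrand evaluated at the upper bound for \<open>G\<close> on
      \<open>?S\<close>; the integrand decreases in \<open>G\<close>, so this bounds it from
      below.\<close>
    define m where "m = 1 / (A * (t ^ Suc k)\<^sup>2) powr s"
    have m0: "m \<ge> 0"
      by (simp add: m_def)
    have "ennreal (m * (c * (\<Prod>i\<in>UNIV. (a i)\<^sup>2))) = ennreal m * ennreal (c * (\<Prod>i\<in>UNIV. (a i)\<^sup>2))"
      using m0 N(3) by (intro ennreal_mult) (auto intro!: mult_nonneg_nonneg prod_nonneg)
    also have "\<dots> \<le> ennreal m * emeasure lborel ?S"
      by (intro mult_left_mono S) auto
    also have "\<dots> = (\<integral>\<^sup>+x. ennreal m * indicator ?S x \<partial>lborel)"
      using S by (subst nn_integral_cmult_indicator) auto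
    also have "\<dots> \<le> (\<integral>\<^sup>+x. ennreal (h x) \<partial>lborel)"
    proof (rule nn_integral_mono_AE)
      show "AE x in lborel. ennreal m * indicator ?S x \<le> ennreal (h x)"
        using nz'
      proof eventually_elim
        case (elim x)
        show ?case
        proof (cases "x \<in> ?S")
          case True
          have "a i \<le> \<delta> * t ^ l i" for i
            using d t by (auto simp: a_def intro!: mult_right_mono)
          then have "G x \<le> A * (t ^ Suc k)\<^sup>2"
            using True N(2) t by (intro V(3)) (auto intro: order_trans)
          then have "G x powr s \<le> (A * (t ^ Suc k)\<^sup>2) powr s"
            using elim s by (intro powr_mono2) auto
          then have "m \<le> 1 / G x powr s"
            unfolding m_def using elim by (intro divide_left_mono mult_pos_pos) auto
          then show ?thesis
            using True N(2) by (auto simp: h_def intro!: ennreal_leI)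
        qed auto
      qed
    qed
    finally have "m * (c * (\<Prod>i\<in>UNIV. (a i)\<^sup>2)) \<le> I"
      unfolding I using I0 by (simp add: ennreal_le_iff)
    moreover have "(\<Prod>i\<in>UNIV. (a i)\<^sup>2) = (d\<^sup>2) ^ CARD('n) * exp (- 2 * real \<Lambda> * u)"
    proof -
      have "(\<Prod>i\<in>UNIV. (a i)\<^sup>2) = (\<Prod>i\<in>(UNIV::'n set). d\<^sup>2 * (t\<^sup>2) ^ l i)"
        by (intro prod.cong) (auto simp: a_def power_mult_distrib power_mult[symmetric] mult.commute)
      also have "\<dots> = (d\<^sup>2) ^ CARD('n) * (t\<^sup>2) ^ \<Lambda>"
        by (simp add: prod.distrib \<Lambda>_def power_sum)
      also have "(t\<^sup>2) ^ \<Lambda> = exp (- 2 * real \<Lambda> * u)"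
        by (simp add: t_def exp_of_nat_mult[symmetric] power2_eq_square exp_add[symmetric])
      finally show ?thesis .
    qed
    moreover have "m = exp (2 * s * real (Suc k) * u) / A powr s"
    proof -
      have "(t ^ Suc k)\<^sup>2 = exp (- 2 * real (Suc k) * u)"
        unfolding t_def exp_of_nat_mult[symmetric] by (simp add: exp_double[symmetric] algebra_simps)
      then have "((t ^ Suc k)\<^sup>2) powr s = exp (- 2 * s * real (Suc k) * u)"
        by (simp only: exp_powr_real) (simp add: algebra_simps)
      then have "m = 1 / (A powr s * exp (- 2 * s * real (Suc k) * u))"
        unfolding m_def using A by (simp add: powr_mult)
      moreover have "exp (- 2 * s * real (Suc k) * u) = 1 / exp (2 * s * real (Suc k) * u)"
        using exp_minus[of "2 * s * real (Suc k) * u"] by (simp only: inverse_eq_divide minus_mult_left)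
      ultimately show ?thesis
        by (simp only:) simp
    qed
    ultimately have "exp (2 * s * real (Suc k) * u) / A powr s * (c * ((d\<^sup>2) ^ CARD('n) * exp (- 2 * real \<Lambda> * u))) \<le> I"
      by simp
    also have "exp (2 * s * real (Suc k) * u) / A powr s * (c * ((d\<^sup>2) ^ CARD('n) * exp (- 2 * real \<Lambda> * u)))
        = K * (exp (2 * s * real (Suc k) * u) * exp (- 2 * real \<Lambda> * u))"
      by (simp add: K_def)
    also have "exp (2 * s * real (Suc k) * u) * exp (- 2 * real \<Lambda> * u) = exp (e * u)"
      unfolding exp_add[symmetric] e_def by (simp add: algebra_simps)
    finally show ?thesis .
  qed
  \<comment> \<open>The first entry makes \<open>K * (1 + e * u)\<close> exceed \<open>I\<close>;
    the others ensure \<open>u > 0\<close> and \<open>exp (- u) < \<delta>\<close>.\<close>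
  define u where "u = max (I / (K * e)) (max 1 (1 - ln \<delta>))"
  have "exp (- u) \<le> exp (ln \<delta> - 1)"
    by (simp add: u_def)
  also have "\<dots> < exp (ln \<delta>)"
    by simp
  also have "exp (ln \<delta>) = \<delta>"
    using A by simp
  finally have "K * exp (e * u) \<le> I"
    by (intro main) (auto simp: u_def)
  moreover have "K * (1 + e * u) \<le> K * exp (e * u)"
    using K by (intro mult_left_mono exp_ge_add_one_self) auto
  moreover have "I \<le> K * (e * u)"
  proof -
    have "I / (K * e) \<le> u"
      by (simp add: u_def)
    then show ?thesis
      using K e by (simp add: field_simps)
  qed
  ultimately show False
    using K by (simp add: algebra_simps)
qed


subsection \<open>Integrability of products of negative powers\<close>

text \<open>The two half-lines contribute equally by reflection, and on the positive one
  \<open>u powr - \<beta>\<close> has a primitive of positive exponent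
  \<open>1 - \<beta>\<close>.\<close>

lemma nn_integral_powr_finite:
  fixes \<beta> R :: real
  assumes \<beta>: "\<beta> < 1" and R: "R \<ge> 0"
  shows "(\<integral>\<^sup>+u. ennreal (\<bar>u\<bar> powr - \<beta> * indicator {- R..R} u) \<partial>lborel) < \<infinity>"
proof -
  define g :: "real \<Rightarrow> ennreal" where "g u = ennreal (indicator {0..R} u * u powr - \<beta>)" for u
  have gm [measurable]: "g \<in> borel_measurable borel"
    unfolding g_def by measurable
  have "(\<integral>\<^sup>+u. g u \<partial>lborel) = ennreal (R powr (- \<beta> + 1) / (- \<beta> + 1))"
    unfolding g_def using \<beta> R
    by (intro nn_integral_has_integral_lebesgue has_integral_powr_from_0) auto
  then have fin: "(\<integral>\<^sup>+u. g u \<partial>lborel) < \<infinity>"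
    by simp
  have "(\<integral>\<^sup>+u. ennreal (\<bar>u\<bar> powr - \<beta> * indicator {- R..R} u) \<partial>lborel) \<le> (\<integral>\<^sup>+u. g u + g (0 + (- 1) * u) \<partial>lborel)"
    by (intro nn_integral_mono) (auto simp: g_def indicator_def abs_if)
  also have "\<dots> = (\<integral>\<^sup>+u. g u \<partial>lborel) + (\<integral>\<^sup>+u. g (0 + (- 1) * u) \<partial>lborel)"
    by (intro nn_integral_add) auto
  also have "(\<integral>\<^sup>+u. g (0 + (- 1) * u) \<partial>lborel) = (\<integral>\<^sup>+u. g u \<partial>lborel)"
    using nn_integral_real_affine[OF gm, of "- 1" 0] by simp
  finally show ?thesis
    using fin by (auto intro: le_less_trans)
qed

lemma nn_integral_prod_powr_finite:
  fixes \<gamma> :: "'a::euclidean_space \<Rightarrow> real"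
  assumes "\<And>b. b \<in> Basis \<Longrightarrow> \<gamma> b < 1" and R: "R \<ge> 0"
  shows "(\<integral>\<^sup>+x. ennreal (\<Prod>b\<in>Basis. \<bar>x \<bullet> b\<bar> powr - \<gamma> b * indicator {- R..R} (x \<bullet> b)) \<partial>lborel) < \<infinity>"
proof -
  have "(\<integral>\<^sup>+x. ennreal (\<Prod>b\<in>Basis. \<bar>x \<bullet> b\<bar> powr - \<gamma> b * indicator {- R..R} (x \<bullet> b)) \<partial>lborel)
      = (\<Prod>b\<in>Basis. \<integral>\<^sup>+u. ennreal (\<bar>u\<bar> powr - \<gamma> b * indicator {- R..R} u) \<partial>lborel)"
    by (subst nn_integral_lborel_prod[symmetric]) (auto simp: prod_ennreal)
  also have "\<dots> < \<infinity>"
  proof -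
    \<comment> \<open>Generalized from the whole basis to finite subsets so that induction
      applies.\<close>
    have "(\<Prod>b\<in>B. \<integral>\<^sup>+u. ennreal (\<bar>u\<bar> powr - \<gamma> b * indicator {- R..R} u) \<partial>lborel) < \<infinity>"
      if "finite B" "B \<subseteq> Basis" for B
      using that
    proof (induction B)
      case (insert b B)
      then show ?case
        using nn_integral_powr_finite[OF assms(1)[of b] R] by (simp add: ennreal_mult_less_top)
    qed simp
    then show ?thesis by simp
  qed
  finally show ?thesis .
qed


subsection \<open>Linear programming duality for the Newton polyhedron\<close>

text \<open>Injectivity of \<open>v\<close> lets the weights on points be pulled back to weights on
  \<open>A\<close> without counting a point twice.\<close>

lemma convex_hull_image_finite:
  fixes v :: "'b \<Rightarrow> 'a::real_vector"
  assumes "finite A" "inj_on v A" "x \<in> convex hull (v ` A)"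
  obtains w where "\<And>\<alpha>. \<alpha> \<in> A \<Longrightarrow> 0 \<le> w \<alpha>" "sum w A = 1" "(\<Sum>\<alpha>\<in>A. w \<alpha> *\<^sub>R v \<alpha>) = x"
proof -
  obtain u where "\<forall>x\<in>v ` A. 0 \<le> u x" "sum u (v ` A) = 1" "(\<Sum>x\<in>v ` A. u x *\<^sub>R x) = x"
    using assms(3) convex_hull_finite[of "v ` A"] assms(1) by auto
  then show ?thesis
    using assms(2) by (intro that[of "u \<circ> v"]) (auto simp: sum.reindex)
qed

text \<open>
  If \<open>(1/s, \<dots>, 1/s)\<close> is not in the Newton polyhedron of \<open>A\<close>, then a separating hyperplane has a
  nonnegative normal vector, and rounding a large multiple of it gives a forbidden integer weight.
\<close>

lemma newton_polyhedron_weights: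
  fixes A :: "('n::finite \<Rightarrow>\<^sub>0 nat) set"
  assumes A: "finite A" "A \<noteq> {}" and s: "s > 0"
    and bound: "\<And>l k. l \<noteq> (\<lambda>_. 0) \<Longrightarrow> (\<And>\<alpha>. \<alpha> \<in> A \<Longrightarrow> k \<le> (\<Sum>i\<in>UNIV. l i * Poly_Mapping.lookup \<alpha> i)) \<Longrightarrow>
      s * real k \<le> real (\<Sum>i\<in>UNIV. l i)"
  shows "\<exists>w. (\<forall>\<alpha>\<in>A. 0 \<le> w \<alpha>) \<and> sum w A = 1 \<and>
    (\<forall>i. s * (\<Sum>\<alpha>\<in>A. w \<alpha> * real (Poly_Mapping.lookup \<alpha> i)) \<le> 1)"
proof -
  define v :: "('n \<Rightarrow>\<^sub>0 nat) \<Rightarrow> real ^ 'n" where "v \<alpha> = (\<chi> i. real (Poly_Mapping.lookup \<alpha> i))" for \<alpha>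
  have inj: "inj_on v A"
    by (auto simp: inj_on_def v_def vec_eq_iff intro: poly_mapping_eqI)
  \<comment> \<open>The corner with all coordinates \<open>1 / s\<close> minus the nonnegative
    orthant: \<open>S\<close> meets the convex hull \<open>T\<close> exactly when the corner lies in
    the Newton polyhedron. \<open>S\<close> is closed and \<open>T\<close> compact, so disjointness
    would give strict separation.\<close>
  define S :: "(real ^ 'n) set" where "S = {x. \<forall>i. x $ i \<le> 1 / s}"
  define T where "T = convex hull (v ` A)"
  have "S \<inter> T \<noteq> {}"
  proof
    assume disj: "S \<inter> T = {}"
    have "convex S"
    proof -
      have "S = (\<Inter>i. {x. axis i 1 \<bullet> x \<le> 1 / s})"
        by (auto simp: S_def inner_axis')
      then show ?thesis
        by (auto intro!: convex_INT convex_halfspace_le)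
    qed
    moreover have "closed S"
      unfolding S_def by (intro closed_Collect_all closed_Collect_le continuous_intros)
    moreover have "compact T" "convex T" "T \<noteq> {}"
      using A by (auto simp: T_def finite_imp_compact_convex_hull)
    ultimately obtain a b where ab: "\<And>x. x \<in> S \<Longrightarrow> a \<bullet> x < b" "\<And>x. x \<in> T \<Longrightarrow> a \<bullet> x > b"
      using separating_hyperplane_closed_compact[of S T] disj by blast
    have inner: "a \<bullet> x = (\<Sum>i\<in>UNIV. a $ i * x $ i)" for x
      by (simp add: inner_vec_def)
    define c where "c = (\<Sum>i\<in>UNIV. a $ i) / s"
    have c: "c < b"
    proof -
      have "a \<bullet> (\<chi> i. 1 / s) < b"
        by (rule ab) (simp add: S_def)
      then show ?thesis
        by (simp add: inner c_def sum_divide_distrib)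
    qed
    have a0: "a $ i \<ge> 0" for i
    proof (rule ccontr)
      assume neg: "\<not> a $ i \<ge> 0"
      \<comment> \<open>Lowering coordinate \<open>i\<close> of the corner by \<open>r\<close> stays
        in \<open>S\<close>, yet raises the value of the functional from \<open>c\<close> to exactly
        \<open>b\<close>.\<close>
      define r where "r = (b - c) / (- (a $ i))"
      have r: "r \<ge> 0"
        unfolding r_def using neg c by (intro divide_nonneg_pos) auto
      have "a \<bullet> ((\<chi> i. 1 / s) - r *\<^sub>R axis i 1) < b"
        using r s by (intro ab(1)) (auto simp: S_def axis_def)
      moreover have "a \<bullet> ((\<chi> i. 1 / s) - r *\<^sub>R axis i 1) = c - r * a $ i"
        by (simp add: inner_diff_right inner_axis inner c_def sum_divide_distrib)
      moreover have "c - r * a $ i = b"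
        using neg by (simp add: r_def)
      ultimately show False by simp
    qed
    \<comment> \<open>\<open>M\<close> bounds the degree of every exponent in \<open>A\<close>,
      hence the loss in the weighted degree when each \<open>real N * a $ i\<close> is rounded down.
      \<open>N\<close> is then chosen so that the gap \<open>real N * (b - c)\<close> exceeds this
      loss.\<close>
    define M where "M = (\<Sum>\<alpha>\<in>A. \<Sum>i\<in>UNIV. real (Poly_Mapping.lookup \<alpha> i))"
    have M: "(\<Sum>i\<in>UNIV. real (Poly_Mapping.lookup \<alpha> i)) \<le> M" if "\<alpha> \<in> A" for \<alpha>
      unfolding M_def using that A
      by (intro member_le_sum[of \<alpha> A "\<lambda>\<alpha>. \<Sum>i\<in>UNIV. real (Poly_Mapping.lookup \<alpha> i)"]) (auto intro!: sum_nonneg)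
    obtain N :: nat where N: "M / (b - c) < real N"
      using reals_Archimedean2 by blast
    then have N: "M < real N * (b - c)"
      using c by (simp add: field_simps)
    define l where "l i = nat \<lfloor>real N * a $ i\<rfloor>" for i
    have l: "real (l i) \<le> real N * a $ i" "real N * a $ i \<le> real (l i) + 1" for i
      using a0[of i] by (auto simp: l_def)
    have big: "real (\<Sum>i\<in>UNIV. l i) < s * real (\<Sum>i\<in>UNIV. l i * Poly_Mapping.lookup \<alpha> i)"
      if \<alpha>: "\<alpha> \<in> A" for \<alpha>
    proof -
      have "v \<alpha> \<in> T"
        using \<alpha> by (auto simp: T_def hull_inc)
      then have "b < (\<Sum>i\<in>UNIV. a $ i * real (Poly_Mapping.lookup \<alpha> i))"
        using ab(2)[of "v \<alpha>"] by (simp add: inner v_def)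
      then have "real N * b \<le> real N * (\<Sum>i\<in>UNIV. a $ i * real (Poly_Mapping.lookup \<alpha> i))"
        by (intro mult_left_mono) auto
      also have "\<dots> = (\<Sum>i\<in>UNIV. real N * a $ i * real (Poly_Mapping.lookup \<alpha> i))"
        by (simp add: sum_distrib_left mult.assoc)
      also have "\<dots> \<le> (\<Sum>i\<in>UNIV. (real (l i) + 1) * real (Poly_Mapping.lookup \<alpha> i))"
        by (intro sum_mono mult_right_mono l) auto
      also have "\<dots> = real (\<Sum>i\<in>UNIV. l i * Poly_Mapping.lookup \<alpha> i) + (\<Sum>i\<in>UNIV. real (Poly_Mapping.lookup \<alpha> i))"
        by (simp add: distrib_right sum.distrib)
      also have "\<dots> < real (\<Sum>i\<in>UNIV. l i * Poly_Mapping.lookup \<alpha> i) + real N * (b - c)"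
        using M[OF \<alpha>] N by simp
      finally have "real N * c < real (\<Sum>i\<in>UNIV. l i * Poly_Mapping.lookup \<alpha> i)"
        by (simp add: algebra_simps)
      then have "s * (real N * c) < s * real (\<Sum>i\<in>UNIV. l i * Poly_Mapping.lookup \<alpha> i)"
        using s by (intro mult_strict_left_mono)
      moreover have "s * (real N * c) = (\<Sum>i\<in>UNIV. real N * a $ i)"
        using s by (simp add: c_def flip: sum_distrib_left)
      moreover have "real (\<Sum>i\<in>UNIV. l i) \<le> (\<Sum>i\<in>UNIV. real N * a $ i)"
        unfolding of_nat_sum by (intro sum_mono l)
      ultimately show ?thesis by linarith
    qed
    obtain \<alpha>0 where \<alpha>0: "\<alpha>0 \<in> A"
      using A by blast
    have lnz: "l \<noteq> (\<lambda>_. 0)"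
      using big[OF \<alpha>0] by auto
    \<comment> \<open>The minimal weighted degree is an admissible \<open>k\<close> and is attained
      at some \<open>\<alpha>\<close>, where \<open>big\<close> contradicts
      \<open>bound\<close>.\<close>
    define k where "k = Min ((\<lambda>\<alpha>. \<Sum>i\<in>UNIV. l i * Poly_Mapping.lookup \<alpha> i) ` A)"
    have "k \<in> (\<lambda>\<alpha>. \<Sum>i\<in>UNIV. l i * Poly_Mapping.lookup \<alpha> i) ` A"
      unfolding k_def using A by (intro Min_in) auto
    then obtain \<alpha> where \<alpha>: "\<alpha> \<in> A" "k = (\<Sum>i\<in>UNIV. l i * Poly_Mapping.lookup \<alpha> i)"
      by blast
    have "s * real k \<le> real (\<Sum>i\<in>UNIV. l i)"
      by (rule bound[OF lnz]) (use A in \<open>auto simp: k_def\<close>)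
    with big[OF \<alpha>(1)] \<alpha>(2) show False by simp
  qed
  then obtain x where x: "x \<in> S" "x \<in> T" by blast
  obtain w where w: "\<And>\<alpha>. \<alpha> \<in> A \<Longrightarrow> 0 \<le> w \<alpha>" "sum w A = 1" "(\<Sum>\<alpha>\<in>A. w \<alpha> *\<^sub>R v \<alpha>) = x"
    using convex_hull_image_finite[OF A(1) inj x(2)[unfolded T_def]] by blast
  have "s * (\<Sum>\<alpha>\<in>A. w \<alpha> * real (Poly_Mapping.lookup \<alpha> i)) \<le> 1" for i
  proof -
    have "(\<Sum>\<alpha>\<in>A. w \<alpha> * real (Poly_Mapping.lookup \<alpha> i)) = x $ i"
      by (simp add: w(3)[symmetric] v_def)
    also have "\<dots> \<le> 1 / s"
      using x(1) by (simp add: S_def)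
    finally show ?thesis
      using s by (simp add: field_simps)
  qed
  with w show ?thesis by blast
qed


subsection \<open>Integrability from a point of the Newton polyhedron\<close>

text \<open>The sum of the monomials dominates the product of the
  \<open>cmod (x $ i) powr \<beta> i\<close>. Each squared modulus then dominates the product of the
  absolute real and imaginary parts, which reduces the integral to one-dimensional ones with
  exponents \<open>s * \<beta> i < 1\<close>; this split keeps the threshold for
  integrability.\<close>

lemma weights_imp_integrable:
  fixes G :: "complex ^ 'n::finite \<Rightarrow> real" and A :: "('n \<Rightarrow>\<^sub>0 nat) set"
  assumes A: "finite A" and w: "\<And>\<alpha>. \<alpha> \<in> A \<Longrightarrow> 0 \<le> w \<alpha>" "sum w A = 1" and s: "s > 0"
    and ws: "\<And>i. s * (\<Sum>\<alpha>\<in>A. w \<alpha> * real (Poly_Mapping.lookup \<alpha> i)) < 1"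
    and U: "open U" "R \<ge> 0" "\<And>x i. x \<in> U \<Longrightarrow> cmod (x $ i) \<le> R"
    and G: "G \<in> borel_measurable borel" and C: "C > 0"
    and le: "\<And>x. x \<in> U \<Longrightarrow> (\<Sum>\<alpha>\<in>A. cmod (monom_eval \<alpha> (\<lambda>i. x $ i)))\<^sup>2 \<le> C * G x"
  shows "set_integrable lborel U (\<lambda>x. 1 / G x powr s)"
proof -
  define \<beta> where "\<beta> i = (\<Sum>\<alpha>\<in>A. w \<alpha> * real (Poly_Mapping.lookup \<alpha> i))" for i
  have \<beta>0: "\<beta> i \<ge> 0" for i
    unfolding \<beta>_def using w by (intro sum_nonneg) auto
  \<comment> \<open>On a basis vector the sum has one term, so \<open>\<gamma>\<close> is
    \<open>s * \<beta> i\<close> for both real directions of coordinate \<open>i\<close>; this form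
    permits products over \<open>Basis\<close>.\<close>
  define \<gamma> :: "complex ^ 'n \<Rightarrow> real" where "\<gamma> b = s * (\<Sum>i\<in>UNIV. \<beta> i * cmod (b $ i))" for b
  have \<gamma>: "\<gamma> (axis i u) = s * \<beta> i" if "cmod u = 1" for i u
  proof -
    have "(\<Sum>j\<in>UNIV. \<beta> j * cmod (axis i u $ j)) = (\<Sum>j\<in>UNIV. if j = i then \<beta> i else 0)"
      using that by (intro sum.cong) (auto simp: axis_def)
    then show ?thesis
      by (simp add: \<gamma>_def)
  qed
  define F where "F x = (\<Prod>b\<in>Basis. \<bar>x \<bullet> b\<bar> powr - \<gamma> b * indicator {- R..R} (x \<bullet> b))" for x :: "complex ^ 'n"
  have "(\<integral>\<^sup>+x. ennreal (F x) \<partial>lborel) < \<infinity>"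
    unfolding F_def
  proof (rule nn_integral_prod_powr_finite)
    fix b :: "complex ^ 'n" assume "b \<in> Basis"
    then obtain i u where "b = axis i u" "cmod u = 1"
      by (auto simp: Basis_vec_def Basis_complex_def)
    then show "\<gamma> b < 1"
      using ws[of i] by (simp add: \<gamma> \<beta>_def)
  qed fact
  then have fin: "(\<integral>\<^sup>+x. ennreal (C powr s) * ennreal (F x) \<partial>lborel) < \<infinity>"
    by (subst nn_integral_cmult) (auto simp: F_def ennreal_mult_less_top)
  \<comment> \<open>The hyperplanes must be excluded: there \<open>0 powr\<close> is 0, which makes
    \<open>F x\<close> vanish.\<close>
  have bound: "1 / G x powr s \<le> C powr s * F x"
    if x: "x \<in> U" and nz: "\<forall>b\<in>Basis. x \<bullet> b \<noteq> 0" for x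
  proof -
    have re: "Re (x $ i) \<noteq> 0" and im: "Im (x $ i) \<noteq> 0" for i
    proof -
      have "x \<bullet> axis i 1 \<noteq> 0" "x \<bullet> axis i \<i> \<noteq> 0"
        using nz by (simp_all add: Basis_complex_def)
      then show "Re (x $ i) \<noteq> 0" "Im (x $ i) \<noteq> 0"
        by (simp_all add: inner_axis inner_complex_def)
    qed
    have xnz: "x $ i \<noteq> 0" for i
      using re[of i] by force
    define m where "m \<alpha> = cmod (monom_eval \<alpha> (\<lambda>i. x $ i))" for \<alpha>
    have m: "m \<alpha> = (\<Prod>i\<in>UNIV. cmod (x $ i) ^ Poly_Mapping.lookup \<alpha> i)" for \<alpha>
      by (simp add: m_def monom_eval_def prod_norm[symmetric] norm_power)
    have m0: "m \<alpha> > 0" for \<alpha>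
      unfolding m using xnz by (intro prod_pos) auto
    define H where "H = (\<Sum>\<alpha>\<in>A. m \<alpha>)"
    have "A \<noteq> {}"
      using w by auto
    then have H0: "H > 0"
      unfolding H_def using A m0 by (intro sum_pos) auto
    define p where "p = (\<Prod>i\<in>UNIV. cmod (x $ i) powr \<beta> i)"
    have p0: "p > 0"
      unfolding p_def using xnz by (intro prod_pos) auto
    have "p = (\<Prod>i\<in>UNIV. \<Prod>\<alpha>\<in>A. cmod (x $ i) powr (w \<alpha> * real (Poly_Mapping.lookup \<alpha> i)))"
      unfolding p_def \<beta>_def using A xnz by (simp add: powr_sum)
    also have "\<dots> = (\<Prod>\<alpha>\<in>A. \<Prod>i\<in>UNIV. cmod (x $ i) powr (w \<alpha> * real (Poly_Mapping.lookup \<alpha> i)))"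
      by (rule prod.swap)
    also have "\<dots> = (\<Prod>\<alpha>\<in>A. m \<alpha> powr w \<alpha>)"
    proof (rule prod.cong[OF refl])
      fix \<alpha>
      have "m \<alpha> powr w \<alpha> = (\<Prod>i\<in>UNIV. (cmod (x $ i) ^ Poly_Mapping.lookup \<alpha> i) powr w \<alpha>)"
        unfolding m by (rule prod_powr_distrib)
      also have "\<dots> = (\<Prod>i\<in>UNIV. cmod (x $ i) powr (w \<alpha> * real (Poly_Mapping.lookup \<alpha> i)))"
        using xnz by (intro prod.cong) (auto simp: powr_realpow[symmetric] powr_powr mult.commute)
      finally show "(\<Prod>i\<in>UNIV. cmod (x $ i) powr (w \<alpha> * real (Poly_Mapping.lookup \<alpha> i))) = m \<alpha> powr w \<alpha>" ..
    qed
    \<comment> \<open>Every monomial is at most the sum \<open>H\<close>, and the weights add up to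
      1, so the weighted product is at most \<open>H\<close>.\<close>
    also have "\<dots> \<le> (\<Prod>\<alpha>\<in>A. H powr w \<alpha>)"
    proof (rule prod_mono)
      fix \<alpha> assume \<alpha>: "\<alpha> \<in> A"
      have "m \<alpha> \<le> H"
        unfolding H_def using A \<alpha> m0 by (intro member_le_sum) (auto intro: less_imp_le)
      then show "0 \<le> m \<alpha> powr w \<alpha> \<and> m \<alpha> powr w \<alpha> \<le> H powr w \<alpha>"
        using m0[of \<alpha>] w \<alpha> by (auto intro: powr_mono2)
    qed
    also have "\<dots> = H"
      using H0 A w by (simp add: powr_sum[symmetric])
    finally have "p\<^sup>2 \<le> H\<^sup>2"
      using p0 by (intro power_mono) auto
    also have "\<dots> \<le> C * G x"
      using le[OF x] by (simp add: H_def m_def)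
    finally have pG: "p\<^sup>2 \<le> C * G x" .
    moreover have p2: "p\<^sup>2 > 0"
      using p0 by simp
    ultimately have "C * G x > 0"
      by linarith
    then have G0: "G x > 0"
      using C by (simp add: zero_less_mult_iff)
    have "(p\<^sup>2) powr s \<le> (C * G x) powr s"
      using pG s p2 by (intro powr_mono2) auto
    also have "\<dots> = C powr s * G x powr s"
      using C G0 by (simp add: powr_mult)
    finally have "(C powr s) / (C powr s * G x powr s) \<le> (C powr s) / (p\<^sup>2) powr s"
      using p2 C G0 by (intro divide_left_mono mult_pos_pos) auto
    then have "1 / G x powr s \<le> C powr s * (1 / (p\<^sup>2) powr s)"
      using C by simp
    also have "1 / (p\<^sup>2) powr s = (p\<^sup>2) powr - s"
      by (simp add: powr_minus inverse_eq_divide)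
    also have "\<dots> = (\<Prod>i\<in>UNIV. ((cmod (x $ i))\<^sup>2) powr - (s * \<beta> i))"
    proof -
      have "p\<^sup>2 = (\<Prod>i\<in>UNIV. (cmod (x $ i))\<^sup>2 powr \<beta> i)"
        unfolding p_def prod_power_distrib power2_eq_square by (simp add: powr_mult prod.distrib)
      then have "(p\<^sup>2) powr - s = (\<Prod>i\<in>UNIV. ((cmod (x $ i))\<^sup>2 powr \<beta> i) powr - s)"
        by (simp add: prod_powr_distrib)
      then show ?thesis
        by (simp add: powr_powr mult.commute)
    qed
    \<comment> \<open>The exponents are nonpositive, so replacing the base by something smaller
      increases the factor.\<close>
    also have "\<dots> \<le> (\<Prod>i\<in>UNIV. (\<bar>Re (x $ i)\<bar> * \<bar>Im (x $ i)\<bar>) powr - (s * \<beta> i))"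
    proof (rule prod_mono)
      fix i
      have "2 * (\<bar>Re (x $ i)\<bar> * \<bar>Im (x $ i)\<bar>) \<le> (cmod (x $ i))\<^sup>2"
        using sum_squares_bound[of "\<bar>Re (x $ i)\<bar>" "\<bar>Im (x $ i)\<bar>"] by (simp add: cmod_power2)
      then have "\<bar>Re (x $ i)\<bar> * \<bar>Im (x $ i)\<bar> \<le> (cmod (x $ i))\<^sup>2"
        using mult_nonneg_nonneg[of "\<bar>Re (x $ i)\<bar>" "\<bar>Im (x $ i)\<bar>"] by linarith
      then show "0 \<le> ((cmod (x $ i))\<^sup>2) powr - (s * \<beta> i) \<and>
          ((cmod (x $ i))\<^sup>2) powr - (s * \<beta> i) \<le> (\<bar>Re (x $ i)\<bar> * \<bar>Im (x $ i)\<bar>) powr - (s * \<beta> i)"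
        using re im s \<beta>0[of i] by (auto intro!: powr_mono2' mult_pos_pos)
    qed
    also have "\<dots> = (\<Prod>b\<in>Basis. \<bar>x \<bullet> b\<bar> powr - \<gamma> b)"
      unfolding prod_Basis_complex_vec
      by (simp add: inner_axis inner_complex_def \<gamma> powr_mult)
    also have "\<dots> = F x"
      unfolding F_def
    proof (intro prod.cong refl)
      fix b :: "complex ^ 'n" assume "b \<in> Basis"
      then obtain i u where "b = axis i u" "u = 1 \<or> u = \<i>"
        by (auto simp: Basis_vec_def Basis_complex_def)
      then have "\<bar>x \<bullet> b\<bar> \<le> cmod (x $ i)"
        by (auto simp: inner_axis inner_complex_def abs_Re_le_cmod abs_Im_le_cmod)
      also have "\<dots> \<le> R"
        using U x by blast
      finally show "\<bar>x \<bullet> b\<bar> powr - \<gamma> b = \<bar>x \<bullet> b\<bar> powr - \<gamma> b * indicator {- R..R} (x \<bullet> b)"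
        by (auto simp: abs_le_iff indicator_def)
    qed
    finally show ?thesis
      using C by (simp add: mult_left_mono)
  qed
  show ?thesis
    unfolding set_integrable_def
  proof (rule integrableI_bounded)
    show "(\<lambda>x. indicator U x *\<^sub>R (1 / G x powr s)) \<in> borel_measurable lborel"
    proof -
      have [measurable]: "U \<in> sets borel" "G \<in> borel_measurable borel"
        using G U(1) by auto
      show ?thesis by measurable
    qed
    have F0: "F x \<ge> 0" for x
      unfolding F_def by (intro prod_nonneg) auto
    have "(\<integral>\<^sup>+x. ennreal (norm (indicator U x *\<^sub>R (1 / G x powr s))) \<partial>lborel)
        \<le> (\<integral>\<^sup>+x. ennreal (C powr s) * ennreal (F x) \<partial>lborel)"
    proof (rule nn_integral_mono_AE)
      show "AE x in lborel. ennreal (norm (indicator U x *\<^sub>R (1 / G x powr s))) \<le> ennreal (C powr s) * ennreal (F x)"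
        using AE_inner_Basis_nonzero[where 'a = "complex ^ 'n"]
      proof eventually_elim
        case (elim x)
        show ?case
        proof (cases "x \<in> U")
          case True
          then show ?thesis
            using bound[OF True elim] F0[of x] by (simp add: ennreal_mult[symmetric] ennreal_leI)
        qed simp
      qed
    qed
    then show "(\<integral>\<^sup>+x. ennreal (norm (indicator U x *\<^sub>R (1 / G x powr s))) \<partial>lborel) < \<infinity>"
      using fin by (rule le_less_trans)
  qed
qed


subsection \<open>Monomial ideals\<close>

text \<open>An ideal element is a combination of the generators whose polynomial coefficients are
  bounded on the compact ball, and each generator is at most the square root of the sum of
  squares.\<close>

lemma ideal_generated_by_bound:
  fixes fs :: "'n::finite mpol list"
  assumes "p \<in> ideal_generated_by (set fs)"
  shows "\<exists>C\<ge>0. \<forall>x\<in>cball 0 1. cmod (poly_eval p x) \<le> C * sqrt (\<Sum>f\<leftarrow>fs. (cmod (poly_eval f x))\<^sup>2)"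
  using assms
proof (induction rule: module.span_induct_alt[OF module_mult, consumes 1, case_names base step])
  case base
  show ?case by (rule exI[of _ 0]) simp
next
  case (step c f q)
  then obtain C where C: "C \<ge> 0"
    "\<And>x. x \<in> cball 0 1 \<Longrightarrow> cmod (poly_eval q x) \<le> C * sqrt (\<Sum>f\<leftarrow>fs. (cmod (poly_eval f x))\<^sup>2)"
    by blast
  have "compact (poly_eval c ` cball 0 1)"
    by (intro compact_continuous_image continuous_on_poly_eval compact_cball)
  then have "bounded (poly_eval c ` cball 0 1)"
    by (rule compact_imp_bounded)
  then obtain M where M: "M > 0" "\<forall>z\<in>poly_eval c ` cball 0 1. cmod z \<le> M"
    unfolding bounded_pos by blast
  show ?case
  proof (intro exI[of _ "M + C"] conjI ballI)
    fix x :: "complex ^ 'n" assume x: "x \<in> cball 0 1"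
    let ?r = "sqrt (\<Sum>f\<leftarrow>fs. (cmod (poly_eval f x))\<^sup>2)"
    have "(cmod (poly_eval f x))\<^sup>2 \<le> (\<Sum>f\<leftarrow>fs. (cmod (poly_eval f x))\<^sup>2)"
    proof -
      obtain xs ys where "fs = xs @ f # ys"
        using step(1) by (meson split_list)
      moreover have "(\<Sum>f\<leftarrow>zs. (cmod (poly_eval f x))\<^sup>2) \<ge> 0" for zs
        by (intro sum_list_nonneg) auto
      ultimately show ?thesis
        by (simp add: add_nonneg_nonneg)
    qed
    then have f: "cmod (poly_eval f x) \<le> ?r"
      by (rule real_le_rsqrt)
    have "cmod (poly_eval (c * f + q) x) \<le> cmod (poly_eval c x) * cmod (poly_eval f x) + cmod (poly_eval q x)"
      by (simp add: poly_eval_add poly_eval_mult norm_mult[symmetric] norm_triangle_ineq)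
    also have "\<dots> \<le> M * ?r + C * ?r"
      using M x f C(2)[OF x] by (intro add_mono mult_mono) auto
    finally show "cmod (poly_eval (c * f + q) x) \<le> (M + C) * ?r"
      by (simp add: distrib_right)
  qed (use M C in auto)
qed

lemma ideal_generated_by_finite_subset:
  assumes "p \<in> ideal_generated_by B"
  obtains F where "finite F" "F \<subseteq> B" "p \<in> ideal_generated_by F"
proof -
  obtain t r where "p = (\<Sum>a\<in>t. r a * a)" "finite t" "t \<subseteq> B"
    using assms unfolding module.span_explicit[OF module_mult] by blast
  moreover from this have "p \<in> ideal_generated_by t"
    unfolding module.span_explicit[OF module_mult] by blast
  ultimately show ?thesis using that by blast
qed

text \<open>Multiplying by a generating monomial shifts exponents, and addition creates no new ones.
  This extends degree bounds from the generators to every element of the ideal.\<close>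

lemma monomial_ideal_keys:
  fixes p :: "'n mpol"
  assumes "p \<in> ideal_generated_by ((\<lambda>\<alpha>. Poly_Mapping.single \<alpha> 1) ` A)" "\<beta> \<in> Poly_Mapping.keys p"
  shows "\<exists>\<alpha>\<in>A. \<exists>\<gamma>. \<beta> = \<gamma> + \<alpha>"
  using assms
proof (induction arbitrary: \<beta> rule: module.span_induct_alt[OF module_mult, consumes 1, case_names base step])
  case (step c f q)
  then obtain \<alpha> where \<alpha>: "\<alpha> \<in> A" "f = Poly_Mapping.single \<alpha> 1" by blast
  have "\<beta> \<in> Poly_Mapping.keys (c * f) \<or> \<beta> \<in> Poly_Mapping.keys q"
    using step.prems keys_add[of "c * f" q] by blast
  then show ?case
  proof
    assume "\<beta> \<in> Poly_Mapping.keys (c * f)"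
    then show ?thesis
      using keys_mult[of c f] \<alpha> by (auto dest!: subsetD)
  qed (use step.IH in blast)
qed simp

text \<open>Each of the finitely many elements of \<open>fs\<close> involves only finitely many of
  the monomials in \<open>M\<close>, and the union of these already generates.\<close>

lemma monomial_ideal_finite:
  fixes \<aa> :: "'n mpol set"
  assumes "\<aa> = ideal_generated_by ((\<lambda>\<alpha>. Poly_Mapping.single \<alpha> 1) ` M)" "\<aa> = ideal_generated_by (set fs)"
  obtains A where "finite A" "\<aa> = ideal_generated_by ((\<lambda>\<alpha>. Poly_Mapping.single \<alpha> 1) ` A)"
proof -
  have "\<exists>A. finite A \<and> A \<subseteq> M \<and> f \<in> ideal_generated_by ((\<lambda>\<alpha>. Poly_Mapping.single \<alpha> 1) ` A)"
    if f: "f \<in> set fs" for f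
  proof -
    have "f \<in> ideal_generated_by ((\<lambda>\<alpha>. Poly_Mapping.single \<alpha> 1) ` M)"
      using f assms module.span_base[OF module_mult] by blast
    from ideal_generated_by_finite_subset[OF this] obtain F
      where F: "finite F" "F \<subseteq> (\<lambda>\<alpha>. Poly_Mapping.single \<alpha> 1) ` M" "f \<in> ideal_generated_by F" .
    obtain A where "finite A" "A \<subseteq> M" "F = (\<lambda>\<alpha>. Poly_Mapping.single \<alpha> 1) ` A"
      using finite_subset_image[OF F(1,2)] by blast
    with F(3) show ?thesis by blast
  qed
  then obtain A where A: "\<And>f. f \<in> set fs \<Longrightarrow> finite (A f) \<and> A f \<subseteq> M \<and>
      f \<in> ideal_generated_by ((\<lambda>\<alpha>. Poly_Mapping.single \<alpha> 1) ` A f)"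
    by metis
  define B where "B = (\<Union>f\<in>set fs. A f)"
  have "set fs \<subseteq> ideal_generated_by ((\<lambda>\<alpha>. Poly_Mapping.single \<alpha> 1) ` B)"
  proof
    fix f assume f: "f \<in> set fs"
    then have "A f \<subseteq> B"
      by (auto simp: B_def)
    then have "ideal_generated_by ((\<lambda>\<alpha>. Poly_Mapping.single \<alpha> (1::complex)) ` A f)
       \<subseteq> ideal_generated_by ((\<lambda>\<alpha>. Poly_Mapping.single \<alpha> 1) ` B)"
      by (intro module.span_mono[OF module_mult] image_mono)
    then show "f \<in> ideal_generated_by ((\<lambda>\<alpha>. Poly_Mapping.single \<alpha> 1) ` B)"
      using A[OF f] by blast
  qed
  then have "\<aa> \<subseteq> ideal_generated_by ((\<lambda>\<alpha>. Poly_Mapping.single \<alpha> 1) ` B)"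
    unfolding assms(2)
    by (intro module.span_minimal[OF module_mult] module.subspace_span[OF module_mult])
  moreover have "ideal_generated_by ((\<lambda>\<alpha>. Poly_Mapping.single \<alpha> 1) ` B) \<subseteq> \<aa>"
    unfolding assms(1) using A
    by (intro module.span_mono[OF module_mult] image_mono) (auto simp: B_def)
  ultimately show ?thesis
    using A by (intro that[of B]) (auto simp: B_def)
qed


subsection \<open>The standard coordinates\<close>

definition coords :: "'n::{finite,linorder} \<Rightarrow> 'n ratfun" where
  "coords i = Fract (poly_X i) 1"

lemma regular_at_coords [simp]: "regular_at x (coords i)"
  by (simp add: coords_def)

lemma rat_eval_coords [simp]: "rat_eval (coords i) x = x $ i"
  by (simp add: coords_def)

lemma Fract_sum: "Fract (\<Sum>i\<in>I. p i) 1 = (\<Sum>i\<in>I. Fract (p i) 1)"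
proof (induction I rule: infinite_finite_induct)
  case (insert i I)
  have "Fract (p i + sum p I) 1 = Fract (p i) 1 + Fract (sum p I) 1"
    by simp
  with insert show ?case
    by (simp del: add_fract)
qed (simp_all add: Zero_fract_def)

lemma sum_in_max_ideal_sq:
  fixes u v :: "'i::finite \<Rightarrow> 'n::{finite,linorder} ratfun"
  assumes "\<And>i. u i \<in> max_ideal P" "\<And>i. v i \<in> max_ideal P"
  shows "(\<Sum>i\<in>UNIV. u i * v i) \<in> max_ideal_sq P"
proof -
  obtain h where h: "bij_betw h {0..<CARD('i)} (UNIV :: 'i set)"
    using ex_bij_betw_nat_finite[of "UNIV :: 'i set"] by auto
  have "(\<Sum>i\<in>UNIV. u i * v i) = (\<Sum>j<CARD('i). u (h j) * v (h j))"
    using sum.reindex_bij_betw[OF h, of "\<lambda>i. u i * v i"] by (simp add: atLeast0LessThan)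
  then show ?thesis
    unfolding max_ideal_sq_def using assms
    by (intro CollectI exI[of _ "CARD('i)"] exI[of _ "\<lambda>j. u (h j)"] exI[of _ "\<lambda>j. v (h j)"]) auto
qed

text \<open>Spanning: a polynomial vanishing at 0 is a combination of the variables, and replacing
  each coefficient \<open>h i / q\<close> by its value at 0 changes the sum by an element of the
  squared maximal ideal. Independence: differentiate at 0 along each axis.\<close>

lemma local_parameters_coords: "local_parameters 0 (coords :: 'n::{finite,linorder} \<Rightarrow> 'n ratfun)"
  unfolding local_parameters_def
proof (intro conjI allI ballI impI)
  show X: "coords i \<in> max_ideal 0" for i :: 'n
    unfolding coords_def by (rule Fract_in_max_ideal) auto
  fix f :: "'n ratfun" assume "f \<in> max_ideal 0"
  then obtain p q where pq: "f = Fract p q" "poly_eval q 0 \<noteq> 0" "poly_eval p 0 = 0"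
    unfolding max_ideal_def by blast
  obtain h where h: "p = (\<Sum>i\<in>UNIV. poly_X i * h i)"
    using poly_vanishing_at_0[OF pq(3)] by blast
  define c where "c i = poly_eval (h i) 0 / poly_eval q 0" for i
  have "Fract (h i) q - const_rat (c i) = Fract (h i - Poly_Mapping.single 0 (c i) * q) q" for i
    using poly_eval_nz[OF pq(2)] by (simp add: const_rat_def)
  moreover have "Fract (h i - Poly_Mapping.single 0 (c i) * q) q \<in> max_ideal 0" for i
    by (rule Fract_in_max_ideal) (use pq in \<open>auto simp: poly_eval_diff poly_eval_mult c_def\<close>)
  ultimately have mem: "Fract (h i) q - const_rat (c i) \<in> max_ideal 0" for i
    by simp
  have "f = Fract p 1 * Fract 1 q"
    by (simp add: pq(1))
  also have "\<dots> = (\<Sum>i\<in>UNIV. coords i * Fract (h i) q)"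
    by (simp add: h Fract_sum sum_distrib_right coords_def)
  finally have "f - (\<Sum>i\<in>UNIV. const_rat (c i) * coords i) = (\<Sum>i\<in>UNIV. coords i * (Fract (h i) q - const_rat (c i)))"
    by (simp add: right_diff_distrib sum_subtractf mult.commute)
  also have "\<dots> \<in> max_ideal_sq 0"
    by (rule sum_in_max_ideal_sq[OF X mem])
  finally show "\<exists>c. f - (\<Sum>i\<in>UNIV. const_rat (c i) * coords i) \<in> max_ideal_sq 0"
    by blast
next
  fix c :: "'n \<Rightarrow> complex" and j :: 'n
  assume *: "(\<Sum>i\<in>UNIV. const_rat (c i) * coords i) \<in> max_ideal_sq (0 :: complex ^ 'n::{finite,linorder})"
  have "(rat_eval (coords i) has_derivative (\<lambda>h. h $ i)) (at 0)" for i :: 'n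
  proof -
    have "rat_eval (coords i) = (\<lambda>x. x $ i)"
      by auto
    then show ?thesis
      by (simp add: bounded_linear_imp_has_derivative bounded_linear_vec_nth)
  qed
  then have "(rat_eval (\<Sum>i\<in>UNIV. const_rat (c i) * coords i) has_derivative (\<lambda>h. \<Sum>i\<in>UNIV. c i * h $ i)) (at 0)"
    using rat_lincomb[of UNIV 0 coords "\<lambda>i h. h $ i" c] by simp
  from fun_cong[OF has_derivative_unique[OF this max_ideal_sqD(2)[OF *]], of "axis j 1"]
  have "(\<Sum>i\<in>UNIV. c i * axis j 1 $ i) = 0" .
  moreover have "(\<Sum>i\<in>UNIV. c i * axis j 1 $ i) = (\<Sum>i\<in>UNIV. if i = j then c j else 0)"
    by (intro sum.cong) (auto simp: axis_def)
  ultimately show "c j = 0"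
    by simp
qed

lemma ps_eval_finite:
  assumes "finite S" "\<And>\<alpha>. \<alpha> \<notin> S \<Longrightarrow> F \<alpha> = 0"
  shows "ps_eval F z = (\<Sum>\<alpha>\<in>S. F \<alpha> * monom_eval \<alpha> z)"
proof -
  have "ps_eval F z = (\<Sum>\<^sub>\<infinity>\<alpha>\<in>S. F \<alpha> * monom_eval \<alpha> z)"
    unfolding ps_eval_def using assms by (intro infsum_cong_neutral) auto
  then show ?thesis
    using assms(1) by simp
qed

lemma ps_convergent_finite:
  assumes "finite S" "\<And>\<alpha>. \<alpha> \<notin> S \<Longrightarrow> F \<alpha> = 0"
  shows "ps_convergent F"
  unfolding ps_convergent_def
proof (intro exI[of _ 1] conjI finite_nonzero_values_imp_summable_on)
  show "finite {\<alpha> \<in> UNIV. cmod (F \<alpha>) * 1 ^ (\<Sum>i\<in>UNIV. Poly_Mapping.lookup \<alpha> i) \<noteq> 0}"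
    by (rule finite_subset[OF _ assms(1)]) (use assms(2) in auto)
qed simp

lemma has_expansion_coords:
  "has_expansion 0 coords (Fract f 1) (Poly_Mapping.lookup f)"
proof -
  have *: "\<And>\<alpha>. \<alpha> \<notin> Poly_Mapping.keys f \<Longrightarrow> Poly_Mapping.lookup f \<alpha> = 0"
    by (simp add: in_keys_iff)
  show ?thesis
    unfolding has_expansion_def
    by (auto simp: ps_eval_finite[OF finite_keys *] poly_eval_def intro: ps_convergent_finite[OF finite_keys *])
qed

lemma lookup_Abs_poly_mapping_finite:
  "Poly_Mapping.lookup (Abs_poly_mapping g) = (g :: 'v::finite \<Rightarrow> nat)"
  by (rule lookup_Abs_poly_mapping) simp

text \<open>The substitution multiplies each monomial by \<open>t\<close> to its weighted degree,
  which is at least \<open>k\<close>, so \<open>t ^ k\<close> can be split off termwise with a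
  polynomial quotient.\<close>

lemma t_power_divides_polynomial:
  assumes k: "\<And>\<alpha>. \<alpha> \<in> Poly_Mapping.keys f \<Longrightarrow> k \<le> (\<Sum>i\<in>UNIV. l i * Poly_Mapping.lookup \<alpha> i)"
  shows "t_power_divides l k (Poly_Mapping.lookup (f :: 'n::finite mpol))"
proof -
  let ?d = "\<lambda>\<alpha>. \<Sum>i\<in>UNIV. l i * Poly_Mapping.lookup \<alpha> i"
  \<comment> \<open>The exponent of the quotient monomial, with the remaining power of
    \<open>t\<close> at \<open>None\<close>; the subtraction is exact for the keys of
    \<open>f\<close>.\<close>
  define h :: "('n \<Rightarrow>\<^sub>0 nat) \<Rightarrow> ('n option \<Rightarrow>\<^sub>0 nat)" where
    "h \<alpha> = Abs_poly_mapping (case_option (?d \<alpha> - k) (Poly_Mapping.lookup \<alpha>))" for \<alpha>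
  \<comment> \<open>Forgetting the power of \<open>t\<close> inverts \<open>h\<close>, so distinct
    terms of \<open>f\<close> remain distinct in \<open>g\<close>.\<close>
  define r :: "('n option \<Rightarrow>\<^sub>0 nat) \<Rightarrow> ('n \<Rightarrow>\<^sub>0 nat)" where
    "r \<beta> = Abs_poly_mapping (\<lambda>i. Poly_Mapping.lookup \<beta> (Some i))" for \<beta>
  have rh: "r (h \<alpha>) = \<alpha>" for \<alpha>
    by (rule poly_mapping_eqI) (simp add: r_def h_def lookup_Abs_poly_mapping_finite)
  then have inj: "inj_on h A" for A
    by (metis inj_on_inverseI)
  define K where "K = Poly_Mapping.keys f"
  have K: "finite K" by (simp add: K_def)
  define g where "g \<beta> = (if \<beta> \<in> h ` K then Poly_Mapping.lookup f (r \<beta>) else 0)" for \<beta>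
  have g: "ps_eval g z = (\<Sum>\<alpha>\<in>K. Poly_Mapping.lookup f \<alpha> * monom_eval (h \<alpha>) z)" for z
  proof -
    have "ps_eval g z = (\<Sum>\<beta>\<in>h ` K. g \<beta> * monom_eval \<beta> z)"
      by (rule ps_eval_finite) (use K in \<open>auto simp: g_def\<close>)
    also have "\<dots> = (\<Sum>\<alpha>\<in>K. g (h \<alpha>) * monom_eval (h \<alpha>) z)"
      by (simp add: sum.reindex[OF inj])
    also have "\<dots> = (\<Sum>\<alpha>\<in>K. Poly_Mapping.lookup f \<alpha> * monom_eval (h \<alpha>) z)"
      by (intro sum.cong) (auto simp: g_def rh)
    finally show ?thesis .
  qed
  have h: "monom_eval (h \<alpha>) (case_option t y) = t ^ (?d \<alpha> - k) * monom_eval \<alpha> y" for \<alpha> t y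
    by (simp add: monom_eval_def UNIV_option_conv h_def lookup_Abs_poly_mapping_finite prod.reindex)
  have mono: "monom_eval \<alpha> (\<lambda>i. t ^ l i * y i) = t ^ ?d \<alpha> * monom_eval \<alpha> y" for \<alpha> t y
    by (simp add: monom_eval_def power_mult_distrib prod.distrib power_sum power_mult)
  show ?thesis
    unfolding t_power_divides_def
  proof (intro exI[of _ g] conjI exI[of _ 1] allI impI)
    show "ps_convergent g"
      by (rule ps_convergent_finite[of "h ` K"]) (use K in \<open>auto simp: g_def\<close>)
    fix y t
    have "ps_eval (Poly_Mapping.lookup f) (\<lambda>i. t ^ l i * y i)
        = (\<Sum>\<alpha>\<in>K. Poly_Mapping.lookup f \<alpha> * monom_eval \<alpha> (\<lambda>i. t ^ l i * y i))"
      by (rule ps_eval_finite) (auto simp: K_def in_keys_iff)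
    also have "\<dots> = (\<Sum>\<alpha>\<in>K. t ^ k * (Poly_Mapping.lookup f \<alpha> * monom_eval (h \<alpha>) (case_option t y)))"
    proof (intro sum.cong refl)
      fix \<alpha> assume "\<alpha> \<in> K"
      then have "t ^ ?d \<alpha> = t ^ k * t ^ (?d \<alpha> - k)"
        using k by (simp add: K_def flip: power_add)
      then show "Poly_Mapping.lookup f \<alpha> * monom_eval \<alpha> (\<lambda>i. t ^ l i * y i)
          = t ^ k * (Poly_Mapping.lookup f \<alpha> * monom_eval (h \<alpha>) (case_option t y))"
        by (simp add: h mono)
    qed
    also have "\<dots> = t ^ k * ps_eval g (case_option t y)"
      by (simp add: g sum_distrib_left)
    finally show "ps_eval (Poly_Mapping.lookup f) (\<lambda>i. t ^ l i * y i) = t ^ k * ps_eval g (case_option t y)" .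
  qed simp
qed

lemma val_coords_ge:
  assumes "\<And>\<alpha>. \<alpha> \<in> Poly_Mapping.keys f \<Longrightarrow> k \<le> (\<Sum>i\<in>UNIV. l i * Poly_Mapping.lookup \<alpha> i)"
  shows "enat k \<le> val 0 coords l (Fract f 1)"
proof -
  have "enat k \<le> val_ps l (Poly_Mapping.lookup f)"
    unfolding val_ps_def using t_power_divides_polynomial[OF assms] by (intro Sup_upper) auto
  also have "\<dots> \<le> val 0 coords l (Fract f 1)"
    unfolding val_def using has_expansion_coords by (intro SUP_upper) auto
  finally show ?thesis .
qed

lemma ord_ideal_coords_ge:
  assumes \<aa>: "\<aa> = ideal_generated_by ((\<lambda>\<alpha>. Poly_Mapping.single \<alpha> 1) ` A)"
    and k: "\<And>\<alpha>. \<alpha> \<in> A \<Longrightarrow> k \<le> (\<Sum>i\<in>UNIV. l i * Poly_Mapping.lookup \<alpha> i)"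
  shows "enat k \<le> ord_ideal 0 coords l \<aa>"
  unfolding ord_ideal_def
proof (intro INF_greatest val_coords_ge)
  fix f \<beta> assume "f \<in> \<aa>" "\<beta> \<in> Poly_Mapping.keys f"
  then obtain \<alpha> \<gamma> where "\<alpha> \<in> A" "\<beta> = \<gamma> + \<alpha>"
    using monomial_ideal_keys \<aa> by blast
  then show "k \<le> (\<Sum>i\<in>UNIV. l i * Poly_Mapping.lookup \<beta> i)"
    using k[of \<alpha>] by (simp add: lookup_add distrib_left sum.distrib)
qed


subsection \<open>The two inequalities\<close>

text \<open>For \<open>N = 0\<close> the quotient is infinite because \<open>L\<close> is nonzero.
  Infinite \<open>N\<close> is impossible, as \<open>le\<close> would then hold for every
  \<open>k\<close>. Using \<open>Suc k\<close> restricts \<open>le\<close> to positive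
  orders.\<close>

lemma ennreal_le_quotient:
  assumes s: "s > 0" and L: "L \<noteq> 0"
    and le: "\<And>k. enat (Suc k) \<le> N \<Longrightarrow> s * real (Suc k) \<le> real L"
  shows "ennreal s \<le> of_nat L / ennreal_of_enat N"
proof (cases N)
  case (enat k)
  show ?thesis
  proof (cases k)
    case 0
    then show ?thesis
      using enat L by (simp add: zero_enat_def[symmetric] ennreal_divide_zero)
  next
    case (Suc j)
    then have "s * real k \<le> real L"
      using le[of j] enat by simp
    then have "s \<le> real L / real k"
      using Suc by (simp add: field_simps)
    then have "ennreal s \<le> ennreal (real L / real k)"
      by (rule ennreal_leI)
    also have "\<dots> = of_nat L / ennreal_of_enat N"
      using enat Suc by (simp add: divide_ennreal[symmetric] ennreal_of_nat_eq_real_of_nat)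
    finally show ?thesis .
  qed
next
  case infinity
  obtain k :: nat where k: "real L / s < real k"
    using reals_Archimedean2 by blast
  then have "real L < s * real (Suc k)"
    using s by (simp add: field_simps)
  with le[of k] infinity show ?thesis by simp
qed

lemma inverse_antimono_ennreal:
  fixes a b :: ennreal
  shows "a \<le> b \<Longrightarrow> inverse b \<le> inverse a"
  using ereal_inverse_antimono[of "enn2ereal a" "enn2ereal b"]
  by (simp add: less_eq_ennreal.rep_eq inverse_ennreal.rep_eq)

lemma lct_le_rkG:
  fixes fs :: "'n::{finite,linorder} mpol list"
  assumes fs: "set fs \<subseteq> \<aa>" and nz: "AE x in lborel. \<exists>f\<in>set fs. poly_eval f x \<noteq> 0"
  shows "lct 0 fs \<le> rkG 0 \<aa>"
  unfolding lct_def rkG_def rkT_def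
proof (intro Sup_least INF_greatest)
  fix z and y :: "'n \<Rightarrow> 'n ratfun" and l :: "'n \<Rightarrow> nat"
  assume "z \<in> {ennreal s |s. 0 < s \<and> (\<exists>U. open U \<and> 0 \<in> U \<and>
      set_integrable lborel U (\<lambda>x. 1 / (\<Sum>f\<leftarrow>fs. (cmod (poly_eval f x))\<^sup>2) powr s))}"
    and y: "y \<in> {y. local_parameters 0 y}" and l: "l \<in> {l. l \<noteq> (\<lambda>_. 0)}"
  then obtain s U where s: "z = ennreal s" "s > 0" and U: "open U" "0 \<in> U"
    "set_integrable lborel U (\<lambda>x. 1 / (\<Sum>f\<leftarrow>fs. (cmod (poly_eval f x))\<^sup>2) powr s)"
    by blast
  show "z \<le> of_nat (\<Sum>i\<in>UNIV. l i) / ennreal_of_enat (ord_ideal 0 y l \<aa>)"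
    unfolding s(1)
  proof (rule ennreal_le_quotient[OF s(2)])
    show "(\<Sum>i\<in>UNIV. l i) \<noteq> 0"
      using l by auto
    fix k assume k: "enat (Suc k) \<le> ord_ideal 0 y l \<aa>"
    show "s * real (Suc k) \<le> real (\<Sum>i\<in>UNIV. l i)"
    proof (rule integrable_imp_exponent_le[OF _ _ nz U(1,2) s(2) U(3)])
      fix f assume "f \<in> set fs"
      then have "ord_ideal 0 y l \<aa> \<le> val 0 y l (Fract f 1)"
        unfolding ord_ideal_def using fs by (intro INF_lower) auto
      with k show "enat (Suc k) \<le> val 0 y l (Fract f 1)"
        by (rule order_trans)
    qed (use y in auto)
  qed
qed

lemma rkG_le_lct:
  fixes fs :: "'n::{finite,linorder} mpol list" and A :: "('n \<Rightarrow>\<^sub>0 nat) set"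
  assumes A: "finite A" "A \<noteq> {}"
    and \<aa>: "\<aa> = ideal_generated_by ((\<lambda>\<alpha>. Poly_Mapping.single \<alpha> 1) ` A)"
    and fs: "\<aa> = ideal_generated_by (set fs)"
  shows "rkG 0 \<aa> \<le> lct 0 fs"
proof (rule ccontr)
  define G where "G x = (\<Sum>f\<leftarrow>fs. (cmod (poly_eval f x))\<^sup>2)" for x
  assume "\<not> rkG 0 \<aa> \<le> lct 0 fs"
  then have "lct 0 fs < rkG 0 \<aa>"
    by simp
  \<comment> \<open>Integrability for \<open>e\<close> will contradict its lying above the
    threshold. The second value \<open>e'\<close> gives the non-strict polyhedron inequalities,
    which become strict for the smaller \<open>e\<close>.\<close>
  then obtain e where e: "lct 0 fs < e" "e < rkG 0 \<aa>"
    using dense by blast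
  then obtain e' where e': "e < e'" "e' < rkG 0 \<aa>"
    using dense by blast
  obtain s where s: "e = ennreal s" "s \<ge> 0"
    using e' by (cases e) auto
  obtain s' where s': "e' = ennreal s'" "s' \<ge> 0"
    using e' by (cases e') auto
  have s0: "s > 0"
    using e(1) s by (metis ennreal_0 less_eq_real_def not_less_zero)
  have ss': "s < s'"
    using e'(1) s s' by (simp add: ennreal_less_iff)
  have s'0: "s' > 0"
    using s0 ss' by simp
  have bound: "s' * real k \<le> real (\<Sum>i\<in>UNIV. l i)"
    if l: "l \<noteq> (\<lambda>_. 0)" and k: "\<And>\<alpha>. \<alpha> \<in> A \<Longrightarrow> k \<le> (\<Sum>i\<in>UNIV. l i * Poly_Mapping.lookup \<alpha> i)"
    for l :: "'n \<Rightarrow> nat" and k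
  \<comment> \<open>The trivial case is separated because dividing by \<open>k = 0\<close> would
    give no real inequality.\<close>
  proof (cases "k = 0")
    case False
    have ok: "ennreal_of_enat (enat k) \<le> ennreal_of_enat (ord_ideal 0 coords l \<aa>)"
      using ord_ideal_coords_ge[OF \<aa> k] by (simp only: ennreal_of_enat_le_iff)
    have "ennreal s' \<le> rkG 0 \<aa>"
      using e'(2) s' by simp
    also have "\<dots> \<le> rkT 0 coords \<aa>"
      unfolding rkG_def by (intro INF_lower) (simp add: local_parameters_coords)
    also have "\<dots> \<le> of_nat (\<Sum>i\<in>UNIV. l i) / ennreal_of_enat (ord_ideal 0 coords l \<aa>)"
      unfolding rkT_def by (intro INF_lower) (use l in simp)
    also have "\<dots> \<le> of_nat (\<Sum>i\<in>UNIV. l i) / ennreal_of_enat (enat k)"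
      unfolding divide_ennreal_def by (intro mult_left_mono inverse_antimono_ennreal ok) simp
    also have "\<dots> = ennreal (real (\<Sum>i\<in>UNIV. l i) / real k)"
      using False by (simp add: divide_ennreal[symmetric] ennreal_of_nat_eq_real_of_nat del: of_nat_sum)
    finally have "s' \<le> real (\<Sum>i\<in>UNIV. l i) / real k"
      by (subst (asm) ennreal_le_iff) (auto intro!: divide_nonneg_nonneg sum_nonneg)
    then show ?thesis
      using False by (simp add: field_simps)
  qed (simp add: sum_nonneg)
  have "\<exists>w. (\<forall>\<alpha>\<in>A. 0 \<le> w \<alpha>) \<and> sum w A = 1 \<and>
      (\<forall>i. s' * (\<Sum>\<alpha>\<in>A. w \<alpha> * real (Poly_Mapping.lookup \<alpha> i)) \<le> 1)"
    by (rule newton_polyhedron_weights[OF A s'0 bound])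
  then obtain w where w: "\<And>\<alpha>. \<alpha> \<in> A \<Longrightarrow> 0 \<le> w \<alpha>" "sum w A = 1"
    "\<And>i. s' * (\<Sum>\<alpha>\<in>A. w \<alpha> * real (Poly_Mapping.lookup \<alpha> i)) \<le> 1"
    by blast
  have ws: "s * (\<Sum>\<alpha>\<in>A. w \<alpha> * real (Poly_Mapping.lookup \<alpha> i)) < 1" for i
  \<comment> \<open>Passing from \<open>s'\<close> to \<open>s\<close> is strict only for a nonzero
    exponent; for exponent 0 the claim reads 0 < 1.\<close>
  proof (cases "(\<Sum>\<alpha>\<in>A. w \<alpha> * real (Poly_Mapping.lookup \<alpha> i)) = 0")
    case False
    moreover have "(\<Sum>\<alpha>\<in>A. w \<alpha> * real (Poly_Mapping.lookup \<alpha> i)) \<ge> 0"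
      using w by (intro sum_nonneg) auto
    ultimately have "s * (\<Sum>\<alpha>\<in>A. w \<alpha> * real (Poly_Mapping.lookup \<alpha> i))
        < s' * (\<Sum>\<alpha>\<in>A. w \<alpha> * real (Poly_Mapping.lookup \<alpha> i))"
      using ss' by (intro mult_strict_right_mono) auto
    then show ?thesis
      using w(3)[of i] by linarith
  qed simp
  have "\<forall>\<alpha>\<in>A. \<exists>C. C \<ge> 0 \<and> (\<forall>x\<in>cball 0 1. cmod (monom_eval \<alpha> (\<lambda>i. x $ i)) \<le> C * sqrt (G x))"
  proof
    fix \<alpha> assume "\<alpha> \<in> A"
    then have "Poly_Mapping.single \<alpha> 1 \<in> ideal_generated_by ((\<lambda>\<alpha>. Poly_Mapping.single \<alpha> (1::complex)) ` A)"
      by (intro module.span_base[OF module_mult]) auto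
    then have "Poly_Mapping.single \<alpha> 1 \<in> ideal_generated_by (set fs)"
      using \<aa> fs by simp
    from ideal_generated_by_bound[OF this]
    show "\<exists>C. C \<ge> 0 \<and> (\<forall>x\<in>cball 0 1. cmod (monom_eval \<alpha> (\<lambda>i. x $ i)) \<le> C * sqrt (G x))"
      by (simp add: poly_eval_single G_def)
  qed
  from bchoice[OF this] obtain C where "\<forall>\<alpha>\<in>A. C \<alpha> \<ge> 0 \<and>
      (\<forall>x\<in>cball 0 1. cmod (monom_eval \<alpha> (\<lambda>i. x $ i)) \<le> C \<alpha> * sqrt (G x))" ..
  then have C: "\<And>\<alpha>. \<alpha> \<in> A \<Longrightarrow> C \<alpha> \<ge> 0"
    "\<And>\<alpha> x. \<alpha> \<in> A \<Longrightarrow> x \<in> cball 0 1 \<Longrightarrow> cmod (monom_eval \<alpha> (\<lambda>i. x $ i)) \<le> C \<alpha> * sqrt (G x)"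
    by blast+
  \<comment> \<open>The summand 1 makes the constant positive even if all \<open>C \<alpha>\<close>
    are 0.\<close>
  define C' where "C' = 1 + (\<Sum>\<alpha>\<in>A. C \<alpha>)"
  have C': "C' > 0"
    unfolding C'_def using C by (intro add_pos_nonneg sum_nonneg) auto
  have G0: "G x \<ge> 0" for x
    unfolding G_def by (intro sum_list_nonneg) auto
  have "set_integrable lborel (ball 0 1) (\<lambda>x. 1 / G x powr s)"
  proof (rule weights_imp_integrable[OF A(1) w(1,2) s0 ws open_ball, where R = 1 and C = "C'\<^sup>2"])
    show "cmod (x $ i) \<le> 1" if "x \<in> ball 0 1" for x :: "complex ^ 'n::{finite,linorder}" and i
      using that Finite_Cartesian_Product.norm_nth_le[of x i] by simp
    show "G \<in> borel_measurable borel"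
    proof -
      have [measurable]: "poly_eval f \<in> borel_measurable borel" for f :: "'n mpol"
        by (intro borel_measurable_continuous_onI continuous_on_poly_eval)
      have "(\<lambda>x. \<Sum>f\<leftarrow>fs. (cmod (poly_eval f x))\<^sup>2) \<in> borel_measurable borel"
        by (induction fs) simp_all
      then show ?thesis
        by (simp add: G_def[abs_def])
    qed
    show "(\<Sum>\<alpha>\<in>A. cmod (monom_eval \<alpha> (\<lambda>i. x $ i)))\<^sup>2 \<le> C'\<^sup>2 * G x" if x: "x \<in> ball 0 1" for x
    proof -
      have "(\<Sum>\<alpha>\<in>A. cmod (monom_eval \<alpha> (\<lambda>i. x $ i))) \<le> (\<Sum>\<alpha>\<in>A. C \<alpha> * sqrt (G x))"
        using x by (intro sum_mono C) auto
      also have "\<dots> \<le> C' * sqrt (G x)"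
        using G0 by (simp add: C'_def sum_distrib_right[symmetric] mult_right_mono)
      finally have "(\<Sum>\<alpha>\<in>A. cmod (monom_eval \<alpha> (\<lambda>i. x $ i)))\<^sup>2 \<le> (C' * sqrt (G x))\<^sup>2"
        by (intro power_mono sum_nonneg) auto
      then show ?thesis
        using G0 by (simp add: power_mult_distrib)
    qed
  qed (use C' in auto)
  then have "ennreal s \<le> lct 0 fs"
    unfolding lct_def G_def using s0 by (intro Sup_upper) (auto intro!: exI[of _ s] exI[of _ "ball 0 1"])
  with e(1) s(1) show False by simp
qed

theorem theorem10:
  fixes \<aa> :: "'n::{finite,linorder} mpol set"
    and fs :: "'n mpol list"
  assumes "monomial_ideal \<aa>"
    and "\<aa> \<noteq> {0}"
    and "\<aa> \<noteq> UNIV"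
    and "\<aa> = ideal_generated_by (set fs)"
  shows "lct 0 fs = rkG 0 \<aa>"
proof -
  obtain M where "\<aa> = ideal_generated_by ((\<lambda>\<alpha>. Poly_Mapping.single \<alpha> 1) ` M)"
    using assms(1) unfolding monomial_ideal_def by blast
  from monomial_ideal_finite[OF this assms(4)] obtain A where
    A: "finite A" "\<aa> = ideal_generated_by ((\<lambda>\<alpha>. Poly_Mapping.single \<alpha> 1) ` A)" .
  have "A \<noteq> {}"
    using A(2) assms(2) by (auto simp: module.span_empty[OF module_mult])
  then obtain \<alpha> where "\<alpha> \<in> A" by blast
  then have \<alpha>: "Poly_Mapping.single \<alpha> 1 \<in> ideal_generated_by (set fs)"
    unfolding assms(4)[symmetric] A(2) by (intro module.span_base[OF module_mult]) auto
  \<comment> \<open>Off the coordinate hyperplanes the monomial of exponent \<open>\<alpha>\<close>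
    is nonzero, so some element of \<open>fs\<close> is nonzero there.\<close>
  have "AE x in lborel. \<exists>f\<in>set fs. poly_eval f x \<noteq> 0"
    using AE_coordinates_nonzero[where 'n = 'n]
  proof eventually_elim
    case (elim x)
    then have "poly_eval (Poly_Mapping.single \<alpha> 1) x \<noteq> 0"
      by (simp add: poly_eval_single monom_eval_def)
    then show ?case
      using ideal_generated_by_eval_0[OF \<alpha>, of x] by blast
  qed
  moreover have "set fs \<subseteq> \<aa>"
    unfolding assms(4) by (rule module.span_superset[OF module_mult])
  ultimately have "lct 0 fs \<le> rkG 0 \<aa>"
    by (intro lct_le_rkG)
  moreover have "rkG 0 \<aa> \<le> lct 0 fs"
    by (rule rkG_le_lct[OF A(1) \<open>A \<noteq> {}\<close> A(2) assms(4)])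
  ultimately show ?thesis
    by (rule antisym)
qed

end
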